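(* Let $H$ be a nonzero Hilbert space. The sequential effect algebra $\mathcal{E}(H)$, with sequential product $A\circ B=A^{1/2}BA^{1/2}$, is sequentially ordered.
   Context: $\mathcal{E}(H)$ is the set of self-adjoint operators $A$ on $H$ with $0\le A\le I$; it is an effect algebra with zero $0$, unit $I$, $A\oplus B=A+B$ defined if and only if $A+B\in\mathcal{E}(H)$; its induced order ($A\le B$ iff $A\oplus C=B$ for some $C\in\mathcal{E}(H)$) is the usual operator order, and $A'=I-A$. It is known that $A\circ B=A^{1/2}BA^{1/2}$ is a sequential product on $\mathcal{E}(H)$ (i.e. satisfies the axioms (S1)–(S5) below). General definitions. An effect algebra is a system $(E,0,1,\oplus)$ where $0\neq 1\in E$ and $\oplus$ is a partial binary operation on $E$ such that: (A1) if $a\oplus b$ is defined then $b\oplus a$ is defined and $b\oplus a=a\oplus b$; (A2) if $a\oplus b$ and $(a\oplus b)\oplus c$ are defined, then $b\oplus c$ and $a\oplus(b\oplus c)$ are defined and $a\oplus(b\oplus c)=(a\oplus b)\oplus c$; (A3) for every $a\in E$ there is a unique $a'\in E$ with $a\oplus a'=1$; (A4) if $a\oplus 1$ is defined then $a=0$. Write $a\perp b$ if $a\oplus b$ is defined, and $a\le b$ if $a\oplus c=b$ for some $c$ (a partial order). For a binary operation $\circ$ write $a\mid b$ if $a\circ b=b\circ a$. A sequential product on $E$ is a binary operation $\circ\colon E\times E\to E$ such that: (S1) if $b\perp c$ then $a\circ b\perp a\circ c$ and $a\circ(b\oplus c)=a\circ b\oplus a\circ c$; (S2) $1\circ a=a$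 for all $a$; (S3) if $a\circ b=0$ then $a\mid b$; (S4) if $a\mid b$ then $a\mid b'$ and $a\circ(b\circ c)=(a\circ b)\circ c$ for all $c$; (S5) if $c\mid a$ and $c\mid b$ then $c\mid a\circ b$ and, when $a\perp b$, $c\mid(a\oplus b)$. A sequential effect algebra (SEA) is an effect algebra with a sequential product. An element $a\in E$ is sharp if $a\wedge a'=0$; $E_S$ is the set of sharp elements. $E$ is sharply dominating if for every $a\in E$ there is a least element $\widehat{a}\in E_S$ with $a\le\widehat{a}$. A sharply dominating SEA $E$ is sequentially ordered if for all $a,b,c\in E$: (1) $a\le b$ implies that there exists $d\in E$ with $a=b\circ d$; and (2) $c\circ a\le c\circ b$ implies $\widehat{c}\circ a\le\widehat{c}\circ b$. *)

theory Defs
  imports "HOL-Analysis.Analysis"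
begin

section \<open>Effect algebras and sequential effect algebras\<close>

text \<open>
  The partial operation is option-valued: \<open>oplus a b = None\<close> means that the sum is undefined.
  It is defined only for arguments in the carrier \<open>E\<close>.
\<close>

locale effect_algebra =
  fixes E :: "'a set" and zero :: 'a and one :: 'a
    and oplus :: "'a \<Rightarrow> 'a \<Rightarrow> 'a option"
  assumes zero_in: "zero \<in> E"
    and one_in: "one \<in> E"
    and zero_neq_one: "zero \<noteq> one"
    and oplus_carrier: "oplus a b = Some c \<Longrightarrow> a \<in> E \<and> b \<in> E \<and> c \<in> E"
    and A1: "oplus a b = Some c \<Longrightarrow> oplus b a = Some c"
    and A2: "oplus a b = Some d \<Longrightarrow> oplus d c = Some e \<Longrightarrow>
               \<exists>f. oplus b c = Some f \<and> oplus a f = Some e"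
    and A3: "a \<in> E \<Longrightarrow> \<exists>!b. b \<in> E \<and> oplus a b = Some one"
    and A4: "oplus a one = Some b \<Longrightarrow> a = zero"
begin

definition le :: "'a \<Rightarrow> 'a \<Rightarrow> bool" where
  "le a b \<longleftrightarrow> (\<exists>c\<in>E. oplus a c = Some b)"

definition compl :: "'a \<Rightarrow> 'a" where
  "compl a = (THE b. b \<in> E \<and> oplus a b = Some one)"

definition is_meet :: "'a \<Rightarrow> 'a \<Rightarrow> 'a \<Rightarrow> bool" where
  "is_meet a b m \<longleftrightarrow> m \<in> E \<and> le m a \<and> le m b \<and> (\<forall>c\<in>E. le c a \<and> le c b \<longrightarrow> le c m)"

definition sharp_elements :: "'a set" where
  "sharp_elements = {a \<in> E. is_meet a (compl a) zero}"

definition is_least_sharp_above :: "'a \<Rightarrow> 'a \<Rightarrow> bool" where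
  "is_least_sharp_above a s \<longleftrightarrow>
     s \<in> sharp_elements \<and> le a s \<and> (\<forall>t\<in>sharp_elements. le a t \<longrightarrow> le s t)"

definition sharply_dominating :: bool where
  "sharply_dominating \<longleftrightarrow> (\<forall>a\<in>E. \<exists>s. is_least_sharp_above a s)"

definition sharp_hat :: "'a \<Rightarrow> 'a" where
  "sharp_hat a = (THE s. is_least_sharp_above a s)"

end

locale sequential_effect_algebra = effect_algebra E zero one oplus
  for E :: "'a set" and zero one :: 'a and oplus :: "'a \<Rightarrow> 'a \<Rightarrow> 'a option" +
  fixes sprod :: "'a \<Rightarrow> 'a \<Rightarrow> 'a"
  assumes sprod_closed: "a \<in> E \<Longrightarrow> b \<in> E \<Longrightarrow> sprod a b \<in> E"
    and S1: "a \<in> E \<Longrightarrow> oplus b c = Some d \<Longrightarrow>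
               oplus (sprod a b) (sprod a c) = Some (sprod a d)"
    and S2: "a \<in> E \<Longrightarrow> sprod one a = a"
    and S3: "a \<in> E \<Longrightarrow> b \<in> E \<Longrightarrow> sprod a b = zero \<Longrightarrow> sprod a b = sprod b a"
    and S4_compl: "a \<in> E \<Longrightarrow> b \<in> E \<Longrightarrow> sprod a b = sprod b a \<Longrightarrow>
               sprod a (compl b) = sprod (compl b) a"
    and S4_assoc: "a \<in> E \<Longrightarrow> b \<in> E \<Longrightarrow> c \<in> E \<Longrightarrow> sprod a b = sprod b a \<Longrightarrow>
               sprod a (sprod b c) = sprod (sprod a b) c"
    and S5_sprod: "a \<in> E \<Longrightarrow> b \<in> E \<Longrightarrow> c \<in> E \<Longrightarrow>
               sprod c a = sprod a c \<Longrightarrow> sprod c b = sprod b c \<Longrightarrow>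
               sprod c (sprod a b) = sprod (sprod a b) c"
    and S5_oplus: "c \<in> E \<Longrightarrow> sprod c a = sprod a c \<Longrightarrow> sprod c b = sprod b c \<Longrightarrow>
               oplus a b = Some d \<Longrightarrow> sprod c d = sprod d c"

locale sequentially_ordered_sea = sequential_effect_algebra E zero one oplus sprod
  for E :: "'a set" and zero one :: 'a and oplus :: "'a \<Rightarrow> 'a \<Rightarrow> 'a option"
    and sprod :: "'a \<Rightarrow> 'a \<Rightarrow> 'a" +
  assumes sharp_domination: "sharply_dominating"
    and le_imp_sprod: "a \<in> E \<Longrightarrow> b \<in> E \<Longrightarrow> le a b \<Longrightarrow> \<exists>d\<in>E. a = sprod b d"
    and sprod_le_imp_hat: "a \<in> E \<Longrightarrow> b \<in> E \<Longrightarrow> c \<in> E \<Longrightarrow> le (sprod c a) (sprod c b) \<Longrightarrow>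
               le (sprod (sharp_hat c) a) (sprod (sharp_hat c) b)"


section \<open>Complex Hilbert spaces\<close>

text \<open>The inner product is linear in the first argument and conjugate-linear in the second.\<close>

class complex_inner_space = real_normed_vector +
  fixes scaleC :: "complex \<Rightarrow> 'a \<Rightarrow> 'a" (infixr \<open>*\<^sub>C\<close> 75)
    and cinner :: "'a \<Rightarrow> 'a \<Rightarrow> complex"
  assumes scaleC_add_right: "c *\<^sub>C (x + y) = c *\<^sub>C x + c *\<^sub>C y"
    and scaleC_add_left: "(c + d) *\<^sub>C x = c *\<^sub>C x + d *\<^sub>C x"
    and scaleC_scaleC: "c *\<^sub>C d *\<^sub>C x = (c * d) *\<^sub>C x"
    and scaleC_of_real: "complex_of_real r *\<^sub>C x = r *\<^sub>R x"
    and cinner_commute: "cinner x y = cnj (cinner y x)"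
    and cinner_add_left: "cinner (x + y) z = cinner x z + cinner y z"
    and cinner_scaleC_left: "cinner (c *\<^sub>C x) y = c * cinner x y"
    and norm_eq_sqrt_cinner: "norm x = sqrt (Re (cinner x x))"

class complex_hilbert_space = complex_inner_space + complete_space


section \<open>Effects on a Hilbert space\<close>

text \<open>
  Elements of \<^typ>\<open>'h \<Rightarrow>\<^sub>L 'h\<close> are bounded and real-linear; complex linearity is imposed separately.
\<close>

definition complex_linear_op :: "('h::complex_inner_space \<Rightarrow>\<^sub>L 'h) \<Rightarrow> bool" where
  "complex_linear_op A \<longleftrightarrow> (\<forall>c x. blinfun_apply A (c *\<^sub>C x) = c *\<^sub>C blinfun_apply A x)"

definition self_adjoint :: "('h::complex_inner_space \<Rightarrow>\<^sub>L 'h) \<Rightarrow> bool" where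
  "self_adjoint A \<longleftrightarrow> complex_linear_op A \<and>
     (\<forall>x y. cinner (blinfun_apply A x) y = cinner x (blinfun_apply A y))"

text \<open>
  The usual order on self-adjoint operators, for which the quadratic forms are real-valued.
\<close>

definition op_le :: "('h::complex_inner_space \<Rightarrow>\<^sub>L 'h) \<Rightarrow> ('h \<Rightarrow>\<^sub>L 'h) \<Rightarrow> bool" where
  "op_le A B \<longleftrightarrow>
     (\<forall>x. Re (cinner (blinfun_apply A x) x) \<le> Re (cinner (blinfun_apply B x) x))"

definition effects :: "('h::complex_inner_space \<Rightarrow>\<^sub>L 'h) set" where
  "effects = {A. self_adjoint A \<and> op_le 0 A \<and> op_le A id_blinfun}"

definition effect_oplus ::
  "('h::complex_inner_space \<Rightarrow>\<^sub>L 'h) \<Rightarrow> ('h \<Rightarrow>\<^sub>L 'h) \<Rightarrow> ('h \<Rightarrow>\<^sub>L 'h) option" where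
  "effect_oplus A B =
     (if A \<in> effects \<and> B \<in> effects \<and> A + B \<in> effects then Some (A + B) else None)"

text \<open>The positive square root, meaningful for positive self-adjoint \<open>A\<close>.\<close>

definition op_sqrt :: "('h::complex_inner_space \<Rightarrow>\<^sub>L 'h) \<Rightarrow> ('h \<Rightarrow>\<^sub>L 'h)" where
  "op_sqrt A = (THE S. self_adjoint S \<and> op_le 0 S \<and> S o\<^sub>L S = A)"

definition effect_sprod ::
  "('h::complex_inner_space \<Rightarrow>\<^sub>L 'h) \<Rightarrow> ('h \<Rightarrow>\<^sub>L 'h) \<Rightarrow> ('h \<Rightarrow>\<^sub>L 'h)" where
  "effect_sprod A B = op_sqrt A o\<^sub>L B o\<^sub>L op_sqrt A"

end

theory Submission
  imports Defs
begin

text \<open>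
  Everything is done with the real inner product \<open>Re (cinner x y)\<close>. Square roots of effects come
  from a norm-convergent iteration and commute with the commutant. If \<open>A \<circ> B = B \<circ> A\<close>, then
  \<open>A\<^sup>1\<^sup>/\<^sup>2 B\<^sup>1\<^sup>/\<^sup>2\<close> is normal, and being intertwined with a positive operator it is self-adjoint; hence
  \<open>A\<close> and \<open>B\<close> commute, which makes (S3)--(S5) routine. The sharp effects are the projections, and the
  least one above \<open>C\<close> is the strong limit of \<open>I - (I - C)\<^sup>n\<close>; since its range is the closure of the
  range of \<open>C\<^sup>1\<^sup>/\<^sup>2\<close>, it may replace \<open>C\<^sup>1\<^sup>/\<^sup>2\<close> in an inequality of quadratic forms. Finally \<open>A \<le> B\<close> gives
  contractions \<open>K = lim A\<^sup>1\<^sup>/\<^sup>2 F\<^sub>n\<close> and \<open>K\<^sup>* = lim F\<^sub>n A\<^sup>1\<^sup>/\<^sup>2\<close>, where the \<open>F\<^sub>n\<close> approximate the inverse of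
  \<open>B\<^sup>1\<^sup>/\<^sup>2\<close>, and \<open>A = B \<circ> (K\<^sup>* K)\<close>.
\<close>

instance complex_hilbert_space \<subseteq> banach ..

subsection \<open>The underlying real inner product\<close>

definition rinner :: "'h::complex_inner_space \<Rightarrow> 'h \<Rightarrow> real" where
  "rinner x y = Re (cinner x y)"

lemma rinner_commute: "rinner x y = rinner y x"
  unfolding rinner_def by (subst cinner_commute) simp

lemma rinner_add_left: "rinner (x + y) z = rinner x z + rinner y z"
  by (simp add: rinner_def cinner_add_left)

lemma rinner_scaleR_left: "rinner (r *\<^sub>R x) y = r * rinner x y"
  by (simp add: rinner_def cinner_scaleC_left flip: scaleC_of_real)

text \<open>Positivity of the form is extracted from nonnegativity of the norm: \<open>sqrt\<close>
  is negative at negative arguments, so \<open>sqrt (rinner x x) \<ge> 0\<close> forces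
  \<open>rinner x x \<ge> 0\<close>.\<close>

lemma rinner_self: "rinner x x = (norm x)\<^sup>2"
proof -
  have "sqrt (rinner x x) \<ge> 0"
    using norm_ge_zero[of x] unfolding norm_eq_sqrt_cinner rinner_def .
  then have "rinner x x \<ge> 0" by simp
  then show ?thesis by (simp add: norm_eq_sqrt_cinner rinner_def)
qed

text \<open>Cauchy-Schwarz, read off from the square of the triangle inequality.\<close>

lemma rinner_le_norm: "rinner x y \<le> norm x * norm y"
proof -
  have "(norm (x + y))\<^sup>2 \<le> (norm x + norm y)\<^sup>2"
    by (intro power_mono norm_triangle_ineq) simp
  moreover have "(norm (x + y))\<^sup>2 = (norm x)\<^sup>2 + 2 * rinner x y + (norm y)\<^sup>2"
    using rinner_add_left rinner_commute
    by (metis (no_types, opaque_lifting) add.assoc mult_2 rinner_self)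
  ultimately show ?thesis by (simp add: power2_sum)
qed

lemma bounded_bilinear_rinner: "bounded_bilinear rinner"
proof
  fix x y z :: 'a and r :: real
  show "rinner (x + y) z = rinner x z + rinner y z" by (rule rinner_add_left)
  show "rinner x (y + z) = rinner x y + rinner x z"
    by (metis rinner_add_left rinner_commute)
  show "rinner (r *\<^sub>R x) y = r *\<^sub>R rinner x y" by (simp add: rinner_scaleR_left)
  show "rinner x (r *\<^sub>R y) = r *\<^sub>R rinner x y"
    by (metis rinner_scaleR_left rinner_commute real_scaleR_def)
  have "\<bar>rinner x y\<bar> \<le> norm x * norm y" for x y :: 'a
    using rinner_le_norm[of x y] rinner_le_norm[of "- x" y] rinner_scaleR_left[of "- 1" x y]
    by simp
  then show "\<exists>K. \<forall>x y :: 'a. norm (rinner x y) \<le> norm x * norm y * K"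
    by (intro exI[of _ 1]) simp
qed

interpretation rinner: bounded_bilinear rinner
  by (rule bounded_bilinear_rinner)

lemma rinner_eqI: "(\<And>z. rinner x z = rinner y z) \<Longrightarrow> x = y"
  using rinner_self[of "x - y"] by (simp add: rinner.diff_left)

section \<open>Complex scalars as bounded real-linear maps\<close>

lemma norm_scaleC: "norm (c *\<^sub>C x) = cmod c * norm x"
proof -
  have "cinner (c *\<^sub>C x) (c *\<^sub>C x) = c * cnj c * cinner x x"
    by (metis cinner_commute cinner_scaleC_left complex_cnj_mult mult.assoc mult.commute)
  then have "rinner (c *\<^sub>C x) (c *\<^sub>C x) = (cmod c)\<^sup>2 * rinner x x"
    by (simp add: rinner_def complex_mult_cnj cmod_power2)
  then have "(norm (c *\<^sub>C x))\<^sup>2 = (cmod c * norm x)\<^sup>2"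
    by (simp add: rinner_self power_mult_distrib)
  then show ?thesis by simp
qed

lemma scaleC_zero_right: "c *\<^sub>C 0 = (0 :: 'h::complex_inner_space)"
  using norm_scaleC[of c "0 :: 'h"] by simp

lemma scaleC_scaleR: "c *\<^sub>C (r *\<^sub>R x) = r *\<^sub>R (c *\<^sub>C x)"
  by (simp add: scaleC_scaleC mult.commute flip: scaleC_of_real)

lemma scaleC_diff_right: "c *\<^sub>C (x - y) = c *\<^sub>C x - c *\<^sub>C y"
  using scaleC_add_right[of c "x - y" y] by simp

lemma bounded_linear_scaleC: "bounded_linear (\<lambda>x::'h::complex_inner_space. c *\<^sub>C x)"
proof (rule bounded_linear_intro[where K = "cmod c"])
  show "c *\<^sub>C (x + y) = c *\<^sub>C x + c *\<^sub>C y" for x y :: 'h by (rule scaleC_add_right)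
  show "c *\<^sub>C (r *\<^sub>R x) = r *\<^sub>R (c *\<^sub>C x)" for x :: 'h and r by (rule scaleC_scaleR)
  show "norm (c *\<^sub>C x) \<le> norm x * cmod c" for x :: 'h by (simp add: norm_scaleC)
qed

subsection \<open>Self-adjoint operators\<close>

lemma complex_linear_op_simps:
  "complex_linear_op A \<Longrightarrow> A (c *\<^sub>C x) = c *\<^sub>C A x"
  by (simp add: complex_linear_op_def)

text \<open>The imaginary part of \<open>cinner u v\<close> is minus the real form at
  \<open>\<i> *\<^sub>C u\<close> and \<open>v\<close>, so for a complex-linear operator symmetry of
  the real form already gives symmetry of the complex one.\<close>

lemma self_adjoint_iff:
  "self_adjoint A \<longleftrightarrow> complex_linear_op A \<and> (\<forall>x y. rinner (A x) y = rinner x (A y))"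
proof (intro iffI conjI allI; (elim conjE)?)
  assume A: "complex_linear_op A" and sym: "\<forall>x y. rinner (A x) y = rinner x (A y)"
  have im: "Im (cinner u v) = - rinner (\<i> *\<^sub>C u) v" for u v :: 'a
    by (simp add: rinner_def cinner_scaleC_left)
  have "Im (cinner (A x) y) = Im (cinner x (A y))" for x y
    unfolding im complex_linear_op_simps[OF A, symmetric] using sym by simp
  with A sym show "self_adjoint A"
    by (simp add: self_adjoint_def rinner_def complex_eq_iff)
qed (auto simp: self_adjoint_def rinner_def)

lemma self_adjointD: "self_adjoint A \<Longrightarrow> rinner (A x) y = rinner x (A y)"
  by (simp add: self_adjoint_iff)

lemma self_adjoint_0: "self_adjoint 0"
  and self_adjoint_id: "self_adjoint id_blinfun"
  by (simp_all add: scaleC_zero_right self_adjoint_iff complex_linear_op_def rinner.zero_left rinner.zero_right)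

lemma self_adjoint_add: "self_adjoint A \<Longrightarrow> self_adjoint B \<Longrightarrow> self_adjoint (A + B)"
  by (simp add: self_adjoint_iff complex_linear_op_def blinfun.bilinear_simps
      scaleC_add_right rinner.add_left rinner.add_right)

lemma self_adjoint_diff: "self_adjoint A \<Longrightarrow> self_adjoint B \<Longrightarrow> self_adjoint (A - B)"
  by (simp add: self_adjoint_iff complex_linear_op_def blinfun.bilinear_simps
      scaleC_diff_right rinner.diff_left rinner.diff_right)

lemma self_adjoint_scaleR: "self_adjoint A \<Longrightarrow> self_adjoint (r *\<^sub>R A)"
  by (simp add: self_adjoint_iff complex_linear_op_def blinfun.bilinear_simps
      scaleC_scaleR rinner.scaleR_left rinner.scaleR_right)

lemma self_adjoint_compose:
  assumes "self_adjoint A" "self_adjoint B" "\<And>x. A (B x) = B (A x)"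
  shows "self_adjoint (A o\<^sub>L B)"
proof -
  have "rinner (A (B x)) y = rinner x (A (B y))" for x y
    by (simp add: assms(3) self_adjointD[OF assms(1)] self_adjointD[OF assms(2)])
  then show ?thesis
    using assms(1,2) by (simp add: self_adjoint_iff complex_linear_op_def)
qed

lemma self_adjoint_sandwich:
  "self_adjoint A \<Longrightarrow> self_adjoint B \<Longrightarrow> self_adjoint (A o\<^sub>L B o\<^sub>L A)"
  by (simp add: self_adjoint_iff complex_linear_op_def)

section \<open>Strong limits of operators\<close>

lemma complex_linear_op_limit:
  assumes "\<And>n. complex_linear_op (X n)" "\<And>x. (\<lambda>n. X n x) \<longlonglongrightarrow> blinfun_apply L x"
  shows "complex_linear_op L"
  unfolding complex_linear_op_def
proof (intro allI)
  fix c x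
  have "(\<lambda>n. X n (c *\<^sub>C x)) \<longlonglongrightarrow> c *\<^sub>C L x"
    unfolding complex_linear_op_simps[OF assms(1)]
    by (rule bounded_linear.tendsto[OF bounded_linear_scaleC assms(2)])
  then show "L (c *\<^sub>C x) = c *\<^sub>C L x"
    by (rule LIMSEQ_unique[OF assms(2)])
qed

lemma self_adjoint_limit:
  assumes sa: "\<And>n. self_adjoint (X n)" and lim: "\<And>x. (\<lambda>n. X n x) \<longlonglongrightarrow> blinfun_apply L x"
  shows "self_adjoint L"
proof -
  have "rinner (L x) y = rinner x (L y)" for x y
  proof (rule LIMSEQ_unique)
    show "(\<lambda>n. rinner (X n x) y) \<longlonglongrightarrow> rinner (L x) y"
      by (rule rinner.tendsto[OF lim tendsto_const])
    show "(\<lambda>n. rinner (X n x) y) \<longlonglongrightarrow> rinner x (L y)"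
      unfolding self_adjointD[OF sa] by (rule rinner.tendsto[OF tendsto_const lim])
  qed
  moreover have "complex_linear_op L"
  proof (rule complex_linear_op_limit)
    show "complex_linear_op (X n)" for n
      using sa[of n] unfolding self_adjoint_def by blast
  qed (rule lim)
  ultimately show ?thesis by (simp add: self_adjoint_iff)
qed

text \<open>The pointwise limit is linear by uniqueness of limits, and the common bound
  \<open>K\<close> survives the limit, so no uniform boundedness principle enters.\<close>

lemma strong_limit_exists:
  fixes X :: "nat \<Rightarrow> 'h::banach \<Rightarrow>\<^sub>L 'h"
  assumes bound: "\<And>n x. norm (X n x) \<le> K * norm x" and "\<And>x. Cauchy (\<lambda>n. X n x)"
  shows "\<exists>L. \<forall>x. (\<lambda>n. X n x) \<longlonglongrightarrow> blinfun_apply L x"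
proof -
  define l where "l x = lim (\<lambda>n. X n x)" for x
  have l: "(\<lambda>n. X n x) \<longlonglongrightarrow> l x" for x
    unfolding l_def using assms(2) by (simp add: Cauchy_convergent_iff convergent_LIMSEQ_iff)
  have "bounded_linear l"
  proof (rule bounded_linear_intro)
    show "l (x + y) = l x + l y" for x y
      using tendsto_add[OF l l] l[of "x + y"] by (simp add: blinfun.add_right LIMSEQ_unique)
    show "l (r *\<^sub>R x) = r *\<^sub>R l x" for r x
      using tendsto_scaleR[OF tendsto_const l] l[of "r *\<^sub>R x"]
      by (simp add: blinfun.scaleR_right LIMSEQ_unique)
    show "norm (l x) \<le> norm x * K" for x
      by (rule tendsto_upperbound[OF tendsto_norm[OF l]]) (simp_all add: bound mult.commute)
  qed
  then have "blinfun_apply (Blinfun l) = l" by (rule bounded_linear_Blinfun_apply)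
  with l show ?thesis by metis
qed

subsection \<open>Effects\<close>

lemma op_le_iff: "op_le A B \<longleftrightarrow> (\<forall>x. rinner (A x) x \<le> rinner (B x) x)"
  by (simp add: op_le_def rinner_def)

lemma effects_iff:
  "A \<in> effects \<longleftrightarrow>
     self_adjoint A \<and> (\<forall>x. 0 \<le> rinner (A x) x) \<and> (\<forall>x. rinner (A x) x \<le> (norm x)\<^sup>2)"
  by (simp add: effects_def op_le_iff rinner.zero_left rinner_self)

lemma effects_self_adjoint: "A \<in> effects \<Longrightarrow> self_adjoint A"
  by (simp add: effects_iff)

lemma effects_sym: "A \<in> effects \<Longrightarrow> rinner (A x) y = rinner x (A y)"
  by (simp add: effects_iff self_adjointD)

lemma effects_pos: "A \<in> effects \<Longrightarrow> 0 \<le> rinner (A x) x"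
  by (simp add: effects_iff)

lemma effects_le: "A \<in> effects \<Longrightarrow> rinner (A x) x \<le> (norm x)\<^sup>2"
  by (simp add: effects_iff)

lemma effects_0: "0 \<in> effects"
  by (simp add: effects_iff self_adjoint_0 rinner.zero_left)

lemma effects_id: "id_blinfun \<in> effects"
  by (simp add: effects_iff self_adjoint_id rinner_self)

lemma effects_compl: "A \<in> effects \<Longrightarrow> id_blinfun - A \<in> effects"
  by (simp add: effects_iff self_adjoint_diff self_adjoint_id blinfun.diff_left
      rinner.diff_left rinner_self)

text \<open>With \<open>B = I - A\<close>, the operator \<open>A - A\<^sup>2\<close> equals
  \<open>A B A + B A B\<close>, a sum of two positive operators.\<close>

lemma effects_norm_sq:
  assumes A: "A \<in> effects"
  shows "(norm (A x))\<^sup>2 \<le> rinner (A x) x"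
proof -
  let ?B = "id_blinfun - A"
  have "0 \<le> rinner (?B (A x)) (A x) + rinner (A (?B x)) (?B x)"
    using A by (intro add_nonneg_nonneg effects_pos effects_compl)
  also have "\<dots> = rinner (A x) x - (norm (A x))\<^sup>2"
    by (simp add: blinfun.bilinear_simps rinner.diff_left rinner.diff_right effects_sym[OF A, of "A x"]
        rinner_commute[of x] flip: rinner_self)
  finally show ?thesis by simp
qed

lemma effects_norm:
  assumes "A \<in> effects"
  shows "norm (A x) \<le> norm x"
  using effects_norm_sq[OF assms, of x] effects_le[OF assms, of x]
  by (meson abs_le_square_iff abs_norm_cancel norm_ge_zero order_trans power2_le_imp_le)

lemma effects_apply_eq_0:
  assumes "A \<in> effects" "rinner (A x) x \<le> 0"
  shows "A x = 0"
  using effects_norm_sq[OF assms(1), of x] assms(2)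
  by (metis norm_eq_zero order_trans power2_less_eq_zero_iff)

text \<open>Polarization: a symmetric operator whose quadratic form vanishes is zero, applied to the
  difference \<open>D\<close>.\<close>

lemma op_le_antisym:
  assumes "A \<in> effects" "B \<in> effects" "op_le A B" "op_le B A"
  shows "A = B"
proof (rule blinfun_eqI, rule rinner_eqI)
  fix x z
  define D where "D = A - B"
  have D: "rinner (D y) y = 0" for y
    using assms(3,4) by (simp add: D_def op_le_iff blinfun.diff_left rinner.diff_left dual_order.antisym)
  have sym: "rinner (D x) z = rinner (D z) x"
    using assms(1,2) by (metis D_def effects_self_adjoint rinner_commute self_adjointD self_adjoint_diff)
  have "rinner (D (x + z)) (x + z) = 0" by (rule D)
  then have "rinner (D x) z + rinner (D z) x = 0"
    using D by (simp add: blinfun.add_right rinner.add_left rinner.add_right)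
  with sym show "rinner (A x) z = rinner (B x) z"
    by (simp add: D_def blinfun.diff_left rinner.diff_left)
qed

subsection \<open>Square roots\<close>

lemma norm_effect_le_1: "A \<in> effects \<Longrightarrow> norm A \<le> 1"
  by (rule norm_blinfun_bound) (simp_all add: effects_norm)

text \<open>
  The iterates \<open>Y\<close> converge to \<open>I - A\<^sup>1\<^sup>/\<^sup>2\<close> for \<open>B = I - A\<close>; since \<open>norm B \<le> 1\<close>, they are dominated
  by the same iteration on numbers, started from \<open>B = 1\<close>.
\<close>

primrec sqrt_iter :: "('h::real_normed_vector \<Rightarrow>\<^sub>L 'h) \<Rightarrow> nat \<Rightarrow> ('h \<Rightarrow>\<^sub>L 'h)" where
  "sqrt_iter B 0 = 0"
| "sqrt_iter B (Suc n) = (1/2) *\<^sub>R (B + (sqrt_iter B n o\<^sub>L sqrt_iter B n))"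

primrec real_sqrt_iter :: "nat \<Rightarrow> real" where
  "real_sqrt_iter 0 = 0"
| "real_sqrt_iter (Suc n) = (1 + (real_sqrt_iter n)\<^sup>2) / 2"

lemma real_sqrt_iter_bounds: "0 \<le> real_sqrt_iter n \<and> real_sqrt_iter n \<le> 1"
proof (induction n)
  case (Suc n)
  then have "(real_sqrt_iter n)\<^sup>2 \<le> 1" by (simp add: power_le_one)
  then show ?case by simp
qed simp

text \<open>One step of the iteration at \<open>y\<close> adds
  \<open>(1 - y)\<^sup>2 / 2\<close>.\<close>

lemma real_sqrt_iter_mono: "incseq real_sqrt_iter"
proof (rule incseq_SucI)
  fix n
  have "0 \<le> (1 - real_sqrt_iter n)\<^sup>2" by simp
  then show "real_sqrt_iter n \<le> real_sqrt_iter (Suc n)"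
    by (simp add: power2_diff)
qed

lemma real_sqrt_iter_Cauchy: "Cauchy real_sqrt_iter"
proof -
  have "convergent real_sqrt_iter"
    by (rule incseq_convergent[OF real_sqrt_iter_mono, of 1])
       (auto simp: real_sqrt_iter_bounds convergent_def)
  then show ?thesis by (rule convergent_Cauchy)
qed

lemma norm_sqrt_iter:
  assumes "norm B \<le> 1"
  shows "norm (sqrt_iter B n) \<le> real_sqrt_iter n"
proof (induction n)
  case (Suc n)
  let ?Y = "sqrt_iter B n"
  have "norm (?Y o\<^sub>L ?Y) \<le> norm ?Y * norm ?Y" by (rule norm_blinfun_compose)
  also have "\<dots> \<le> (real_sqrt_iter n)\<^sup>2"
    unfolding power2_eq_square by (intro mult_mono Suc) (auto simp: real_sqrt_iter_bounds)
  finally have "norm (B + (?Y o\<^sub>L ?Y)) \<le> 1 + (real_sqrt_iter n)\<^sup>2"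
    using assms by (intro norm_triangle_le add_mono)
  then show ?case by simp
qed simp

text \<open>For consecutive iterates, \<open>Y\<^sup>2 - X\<^sup>2 = Y (Y - X) + (Y - X) X\<close>
  holds without commutativity. Bounding each factor by its numerical counterpart gives
  \<open>y\<^sup>2 - x\<^sup>2\<close>, which is twice the next numerical increment.\<close>

lemma norm_sqrt_iter_step:
  assumes "norm B \<le> 1"
  shows "norm (sqrt_iter B (Suc n) - sqrt_iter B n) \<le> real_sqrt_iter (Suc n) - real_sqrt_iter n"
proof (induction n)
  case 0
  then show ?case using assms by simp
next
  case (Suc n)
  define X Y where "X = sqrt_iter B n" and "Y = sqrt_iter B (Suc n)"
  define x y where "x = real_sqrt_iter n" and "y = real_sqrt_iter (Suc n)"
  have IH: "norm (Y - X) \<le> y - x" using Suc by (simp only: X_def Y_def x_def y_def)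
  have nX: "norm X \<le> x" and nY: "norm Y \<le> y"
    using norm_sqrt_iter[OF assms] by (simp_all only: X_def Y_def x_def y_def)
  have y0: "0 \<le> y" and yx: "0 \<le> y - x"
    using nY IH norm_ge_zero order_trans by blast+
  have eq: "sqrt_iter B (Suc (Suc n)) - sqrt_iter B (Suc n) =
      (1/2) *\<^sub>R ((Y o\<^sub>L (Y - X)) + ((Y - X) o\<^sub>L X))"
  proof (rule blinfun_eqI)
    fix v
    have "sqrt_iter B (Suc (Suc n)) = (1/2) *\<^sub>R (B + (Y o\<^sub>L Y))"
      and "sqrt_iter B (Suc n) = (1/2) *\<^sub>R (B + (X o\<^sub>L X))"
      by (simp_all only: sqrt_iter.simps(2)[of B "Suc n"] sqrt_iter.simps(2)[of B n] X_def Y_def)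
    then show "(sqrt_iter B (Suc (Suc n)) - sqrt_iter B (Suc n)) v =
        ((1/2) *\<^sub>R ((Y o\<^sub>L (Y - X)) + ((Y - X) o\<^sub>L X))) v"
      by (simp only: blinfun.bilinear_simps blinfun_apply_blinfun_compose)
         (simp add: algebra_simps)
  qed
  have "norm (Y o\<^sub>L (Y - X)) \<le> y * (y - x)"
    by (rule order_trans[OF norm_blinfun_compose mult_mono[OF nY IH y0 norm_ge_zero]])
  moreover have "norm ((Y - X) o\<^sub>L X) \<le> (y - x) * x"
    by (rule order_trans[OF norm_blinfun_compose mult_mono[OF IH nX yx norm_ge_zero]])
  ultimately have "norm ((Y o\<^sub>L (Y - X)) + ((Y - X) o\<^sub>L X)) \<le> y * (y - x) + (y - x) * x"
    by (rule norm_triangle_mono)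
  also have "\<dots> = y\<^sup>2 - x\<^sup>2" by (simp add: algebra_simps power2_eq_square)
  finally have "norm (sqrt_iter B (Suc (Suc n)) - sqrt_iter B (Suc n)) \<le> (y\<^sup>2 - x\<^sup>2) / 2"
    unfolding eq by simp
  moreover have "real_sqrt_iter (Suc (Suc n)) = (1 + y\<^sup>2) / 2" "real_sqrt_iter (Suc n) = (1 + x\<^sup>2) / 2"
    by (simp_all only: y_def x_def real_sqrt_iter.simps(2))
  ultimately show ?case by (simp add: field_simps)
qed

text \<open>Summing the increments telescopes on the numerical side, so the Cauchy property is
  inherited from the bounded monotone sequence \<open>real_sqrt_iter\<close>.\<close>

lemma sqrt_iter_Cauchy:
  assumes "norm B \<le> 1"
  shows "Cauchy (sqrt_iter B)"
proof -
  have step: "norm (sqrt_iter B (n + k) - sqrt_iter B n) \<le> real_sqrt_iter (n + k) - real_sqrt_iter n"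
    for n k
  proof (induction k)
    case (Suc k)
    have "norm (sqrt_iter B (n + Suc k) - sqrt_iter B n) \<le>
        norm (sqrt_iter B (Suc (n + k)) - sqrt_iter B (n + k))
        + norm (sqrt_iter B (n + k) - sqrt_iter B n)"
      unfolding add_Suc_right by (metis diff_add_cancel add_diff_eq norm_triangle_ineq)
    also have "\<dots> \<le> (real_sqrt_iter (Suc (n + k)) - real_sqrt_iter (n + k))
        + (real_sqrt_iter (n + k) - real_sqrt_iter n)"
      by (intro add_mono norm_sqrt_iter_step[OF assms] Suc)
    finally show ?case by (simp only: add_Suc_right)
  qed simp
  show ?thesis
  proof (rule metric_CauchyI)
    fix e :: real assume "e > 0"
    then obtain M where M: "\<forall>m\<ge>M. \<forall>n\<ge>M. dist (real_sqrt_iter m) (real_sqrt_iter n) < e"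
      using metric_CauchyD[OF real_sqrt_iter_Cauchy] by blast
    have *: "dist (sqrt_iter B m) (sqrt_iter B n) < e" if "m \<ge> n" "n \<ge> M" for m n
    proof -
      have "norm (sqrt_iter B m - sqrt_iter B n) \<le> real_sqrt_iter m - real_sqrt_iter n"
        using step[of n "m - n"] that by simp
      also have "\<dots> \<le> dist (real_sqrt_iter m) (real_sqrt_iter n)" by (simp add: dist_real_def)
      also have "\<dots> < e" using M that by simp
      finally show ?thesis by (simp add: dist_norm)
    qed
    then have "dist (sqrt_iter B m) (sqrt_iter B n) < e" if "m \<ge> M" "n \<ge> M" for m n
      using that by (metis dist_commute nat_le_linear)
    then show "\<exists>M. \<forall>m\<ge>M. \<forall>n\<ge>M. dist (sqrt_iter B m) (sqrt_iter B n) < e" by blast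
  qed
qed

lemma sqrt_iter_self_adjoint: "self_adjoint B \<Longrightarrow> self_adjoint (sqrt_iter B n)"
  by (induction n) (simp_all add: self_adjoint_0 self_adjoint_scaleR self_adjoint_add self_adjoint_compose)

lemma sqrt_iter_commute:
  fixes B K :: "'h::real_normed_vector \<Rightarrow>\<^sub>L 'h"
  assumes "\<And>x. K (B x) = B (K x)"
  shows "K (sqrt_iter B n x) = sqrt_iter B n (K x)"
  by (induction n arbitrary: x) (simp_all add: blinfun.bilinear_simps assms)

lemma effect_sqrt_exists:
  fixes A :: "'h::complex_hilbert_space \<Rightarrow>\<^sub>L 'h"
  assumes A: "A \<in> effects"
  shows "\<exists>S\<in>effects. S o\<^sub>L S = A \<and> (\<forall>K :: 'h \<Rightarrow>\<^sub>L 'h. (\<forall>x. K (A x) = A (K x)) \<longrightarrow> (\<forall>x. K (S x) = S (K x)))"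
proof -
  define B where "B = id_blinfun - A"
  have B: "B \<in> effects" unfolding B_def by (rule effects_compl[OF A])
  have nB: "norm B \<le> 1" by (rule norm_effect_le_1[OF B])
  obtain Y where Y: "sqrt_iter B \<longlonglongrightarrow> Y"
    using sqrt_iter_Cauchy[OF nB] by (auto simp: Cauchy_convergent_iff convergent_def)
  have Yx: "(\<lambda>n. sqrt_iter B n x) \<longlonglongrightarrow> Y x" for x
    by (rule blinfun.tendsto[OF Y tendsto_const])
  have "(\<lambda>n. sqrt_iter B (Suc n)) \<longlonglongrightarrow> (1/2) *\<^sub>R (B + (Y o\<^sub>L Y))"
    unfolding sqrt_iter.simps
    by (intro tendsto_scaleR tendsto_add tendsto_const
        bounded_bilinear.tendsto[OF bounded_bilinear_blinfun_compose] Y)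
  moreover have "(\<lambda>n. sqrt_iter B (Suc n)) \<longlonglongrightarrow> Y"
    using Y by (rule LIMSEQ_Suc)
  ultimately have fix_Y: "Y = (1/2) *\<^sub>R (B + (Y o\<^sub>L Y))"
    by (rule LIMSEQ_unique[THEN sym])
  have saY: "self_adjoint Y"
    by (rule self_adjoint_limit[OF sqrt_iter_self_adjoint[OF effects_self_adjoint[OF B]] Yx])
  \<comment> \<open>This bound is the source of the positivity of
    \<open>id_blinfun - Y\<close>.\<close>
  have nY: "norm Y \<le> 1"
  proof (rule tendsto_upperbound[OF tendsto_norm[OF Y]])
    show "\<forall>\<^sub>F n in sequentially. norm (sqrt_iter B n) \<le> 1"
      using order_trans[OF norm_sqrt_iter[OF nB] conjunct2[OF real_sqrt_iter_bounds]]
      by (simp add: always_eventually)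
  qed simp
  \<comment> \<open>Expanding the square, the fixed point equation
    \<open>2 Y = B + Y\<^sup>2\<close> says \<open>(I - Y)\<^sup>2 = I - B = A\<close>.\<close>
  define S where "S = id_blinfun - Y"
  have saS: "self_adjoint S"
    unfolding S_def by (intro self_adjoint_diff self_adjoint_id saY)
  have SS: "S (S x) = A x" for x
  proof -
    have "Y x = (1/2) *\<^sub>R (B x + Y (Y x))"
      using arg_cong[OF fix_Y, of "\<lambda>Z. blinfun_apply Z x"] by (simp add: blinfun.bilinear_simps)
    then have "2 *\<^sub>R Y x = 2 *\<^sub>R ((1/2) *\<^sub>R (B x + Y (Y x)))"
      by (rule arg_cong)
    then have "Y x + Y x = x - A x + Y (Y x)"
      by (simp add: B_def blinfun.bilinear_simps scaleR_2)
    then show ?thesis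
      by (simp add: S_def blinfun.bilinear_simps algebra_simps)
  qed
  have S: "S \<in> effects"
    unfolding effects_iff
  proof (intro conjI saS allI)
    fix x
    have "rinner (Y x) x \<le> norm (Y x) * norm x" by (rule rinner_le_norm)
    also have "\<dots> \<le> (1 * norm x) * norm x"
      by (intro mult_right_mono order_trans[OF norm_blinfun] nY) auto
    finally show "0 \<le> rinner (S x) x"
      by (simp add: S_def blinfun.diff_left rinner.diff_left rinner_self power2_eq_square)
    have "(norm (S x))\<^sup>2 = rinner (A x) x"
      by (simp add: SS self_adjointD[OF saS, of x] rinner_commute[of x] flip: rinner_self)
    also have "\<dots> \<le> (norm x)\<^sup>2" by (rule effects_le[OF A])
    finally have "norm (S x) \<le> norm x" by (rule power2_le_imp_le) simp
    then have "norm (S x) * norm x \<le> norm x * norm x" by (rule mult_right_mono) simp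
    then show "rinner (S x) x \<le> (norm x)\<^sup>2"
      using rinner_le_norm[of "S x" x] by (simp add: power2_eq_square)
  qed
  \<comment> \<open>The iterates are polynomials in \<open>B = I - A\<close>, so whatever commutes
    with \<open>A\<close> commutes with them and with their limit.\<close>
  have "K (S x) = S (K x)" if K: "\<And>x. K (A x) = A (K x)" for K :: "'h \<Rightarrow>\<^sub>L 'h" and x
  proof -
    have "K (B x) = B (K x)" for x by (simp add: B_def blinfun.bilinear_simps K)
    then have "(\<lambda>n. K (sqrt_iter B n x)) \<longlonglongrightarrow> Y (K x)"
      by (simp add: sqrt_iter_commute Yx)
    moreover have "(\<lambda>n. K (sqrt_iter B n x)) \<longlonglongrightarrow> K (Y x)"
      by (rule blinfun.tendsto[OF tendsto_const Yx])
    ultimately have "K (Y x) = Y (K x)" by (rule LIMSEQ_unique[THEN sym])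
    then show ?thesis by (simp add: S_def blinfun.bilinear_simps)
  qed
  moreover have "S o\<^sub>L S = A" by (rule blinfun_eqI) (simp add: SS)
  ultimately show ?thesis using S by (intro bexI[of _ S]) simp_all
qed

text \<open>For \<open>y = S x - T x\<close>, commutation gives
  \<open>(S + T) y = S\<^sup>2 x - T\<^sup>2 x = 0\<close>. Both summands are positive, so
  \<open>S y = T y = 0\<close>, and moving \<open>S - T\<close> across the inner product yields
  \<open>(norm y)\<^sup>2 = 0\<close>.\<close>

lemma sqrt_unique:
  assumes S: "S \<in> effects" "S o\<^sub>L S = A"
    and T: "self_adjoint T" "op_le 0 T" "T o\<^sub>L T = A"
    and comm: "\<And>x. T (S x) = S (T x)"
  shows "T = S"
proof (rule blinfun_eqI)
  fix x
  have S2: "S (S z) = A z" for z by (simp add: S(2)[symmetric])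
  have T2: "T (T z) = A z" for z by (simp add: T(3)[symmetric])
  define y where "y = S x - T x"
  have "S y + T y = 0"
    by (simp add: y_def blinfun.bilinear_simps S2 T2 comm)
  then have sum0: "rinner (S y) y + rinner (T y) y = 0"
    by (simp add: rinner.add_left[symmetric] rinner.zero_left)
  have "0 \<le> rinner (T y) y" using T(2) by (simp add: op_le_iff rinner.zero_left)
  then have Sy: "S y = 0" using sum0 effects_apply_eq_0[OF S(1), of y] by simp
  then have "T y = 0" using \<open>S y + T y = 0\<close> by simp
  have "(norm y)\<^sup>2 = rinner (S x) y - rinner (T x) y"
    unfolding rinner_self[symmetric] by (simp add: y_def rinner.diff_left)
  also have "\<dots> = rinner x (S y) - rinner x (T y)"
    by (simp add: effects_sym[OF S(1)] self_adjointD[OF T(1)])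
  finally have "y = 0" by (simp add: Sy \<open>T y = 0\<close> rinner.zero_right)
  then show "T x = S x" by (simp add: y_def)
qed

lemma
  fixes A :: "'h::complex_hilbert_space \<Rightarrow>\<^sub>L 'h"
  assumes A: "A \<in> effects"
  shows op_sqrt_unique_exists: "\<exists>!S. self_adjoint S \<and> op_le 0 S \<and> S o\<^sub>L S = A"
    and op_sqrt_effects: "op_sqrt A \<in> effects"
    and op_sqrt_commute: "\<And>(K :: 'h \<Rightarrow>\<^sub>L 'h) x. (\<And>x. K (A x) = A (K x)) \<Longrightarrow> K (op_sqrt A x) = op_sqrt A (K x)"
proof -
  obtain S where S: "S \<in> effects" "S o\<^sub>L S = A"
    and comm: "\<And>(K :: 'h \<Rightarrow>\<^sub>L 'h) x. (\<And>x. K (A x) = A (K x)) \<Longrightarrow> K (S x) = S (K x)"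
    using effect_sqrt_exists[OF A] by blast
  have ex: "self_adjoint S \<and> op_le 0 S \<and> S o\<^sub>L S = A"
    using S by (simp add: effects_def)
  have uniq: "T = S" if "self_adjoint T \<and> op_le 0 T \<and> T o\<^sub>L T = A" for T
  proof (rule sqrt_unique[OF S])
    have T: "T o\<^sub>L T = A" using that by blast
    \<comment> \<open>\<open>T\<close> commutes with its own square \<open>A\<close>, and
      \<open>S\<close> commutes with everything that commutes with \<open>A\<close>.\<close>
    show "T (S x) = S (T x)" for x
      by (rule comm) (simp add: T[symmetric])
    show "self_adjoint T" "op_le 0 T" "T o\<^sub>L T = A" using that by simp_all
  qed
  have "op_sqrt A = S" unfolding op_sqrt_def using ex uniq by (rule the_equality)
  with S comm show "op_sqrt A \<in> effects"
    and "\<And>(K :: 'h \<Rightarrow>\<^sub>L 'h) x. (\<And>x. K (A x) = A (K x)) \<Longrightarrow> K (op_sqrt A x) = op_sqrt A (K x)"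
    by simp_all
  show "\<exists>!S. self_adjoint S \<and> op_le 0 S \<and> S o\<^sub>L S = A" using ex uniq by blast
qed

lemma op_sqrt_square:
  fixes A :: "'h::complex_hilbert_space \<Rightarrow>\<^sub>L 'h"
  assumes "A \<in> effects"
  shows "op_sqrt A (op_sqrt A x) = A x"
proof -
  have "op_sqrt A o\<^sub>L op_sqrt A = A"
    using theI'[OF op_sqrt_unique_exists[OF assms]] unfolding op_sqrt_def by simp
  then show ?thesis by (metis blinfun_apply_blinfun_compose)
qed

lemma op_sqrt_eqI:
  fixes A :: "'h::complex_hilbert_space \<Rightarrow>\<^sub>L 'h"
  assumes "A \<in> effects" "self_adjoint S" "op_le 0 S" "S o\<^sub>L S = A"
  shows "op_sqrt A = S"
  unfolding op_sqrt_def using assms by (intro the1_equality[OF op_sqrt_unique_exists]) simp_all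

lemma norm_op_sqrt:
  fixes A :: "'h::complex_hilbert_space \<Rightarrow>\<^sub>L 'h"
  assumes "A \<in> effects"
  shows "(norm (op_sqrt A x))\<^sup>2 = rinner (A x) x"
  using op_sqrt_square[OF assms, of x] effects_sym[OF op_sqrt_effects[OF assms], of "op_sqrt A x" x]
  by (simp add: rinner_self)

subsection \<open>Powers and supports of effects\<close>

primrec blinfun_power :: "('h::real_normed_vector \<Rightarrow>\<^sub>L 'h) \<Rightarrow> nat \<Rightarrow> ('h \<Rightarrow>\<^sub>L 'h)" where
  "blinfun_power E 0 = id_blinfun"
| "blinfun_power E (Suc n) = E o\<^sub>L blinfun_power E n"

lemma blinfun_power_add:
  "blinfun_power E (m + n) x = blinfun_power E m (blinfun_power E n x)"
  by (induction m) simp_all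

lemma blinfun_power_Suc_right: "blinfun_power E (Suc n) x = blinfun_power E n (E x)"
  by (induction n) simp_all

lemma blinfun_power_fixed: "blinfun_apply E x = x \<Longrightarrow> blinfun_power E n x = x"
  by (induction n) simp_all

lemma self_adjoint_blinfun_power: "self_adjoint E \<Longrightarrow> self_adjoint (blinfun_power E n)"
proof (induction n)
  case (Suc n)
  have "E (blinfun_power E n x) = blinfun_power E n (E x)" for x
    using blinfun_power_Suc_right[of E n x] by simp
  then show ?case using Suc by (simp add: self_adjoint_compose)
qed (simp add: self_adjoint_id)

text \<open>Moving one factor across the inner product lowers the exponent by two. Statements about
  the forms of powers therefore follow by induction in steps of two, with the exponents 0 and 1 as
  base cases.\<close>

lemma rinner_blinfun_power_Suc_Suc:
  assumes "self_adjoint E"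
  shows "rinner (blinfun_power E (Suc (Suc n)) x) x = rinner (blinfun_power E n (E x)) (E x)"
  using self_adjointD[OF assms] blinfun_power_Suc_right[of E n x] by simp

lemma effects_blinfun_power:
  assumes E: "E \<in> effects"
  shows "blinfun_power E n \<in> effects"
  unfolding effects_iff
proof (intro conjI allI)
  note sa = effects_self_adjoint[OF E]
  show "self_adjoint (blinfun_power E n)" by (rule self_adjoint_blinfun_power[OF sa])
  show "0 \<le> rinner (blinfun_power E n x) x" for x
  proof (induction n arbitrary: x rule: induct_nat_012)
    case (ge2 n)
    show ?case unfolding rinner_blinfun_power_Suc_Suc[OF sa] by (rule ge2(1))
  qed (simp_all add: rinner_self effects_pos[OF E])
  have "norm (blinfun_power E n x) \<le> norm x" for x
    by (induction n) (auto intro: order_trans effects_norm[OF E])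
  then have "norm (blinfun_power E n x) * norm x \<le> norm x * norm x" for x
    by (intro mult_right_mono) simp_all
  then show "rinner (blinfun_power E n x) x \<le> (norm x)\<^sup>2" for x
    unfolding power2_eq_square by (rule order_trans[OF rinner_le_norm])
qed

text \<open>The two base cases are \<open>E \<le> I\<close> and
  \<open>E\<^sup>2 \<le> E\<close>.\<close>

lemma rinner_blinfun_power_decseq:
  assumes E: "E \<in> effects"
  shows "decseq (\<lambda>n. rinner (blinfun_power E n x) x)"
proof (rule decseq_SucI)
  note sa = effects_self_adjoint[OF E]
  show "rinner (blinfun_power E (Suc n) x) x \<le> rinner (blinfun_power E n x) x" for n
  proof (induction n arbitrary: x rule: induct_nat_012)
    case 0
    show ?case using effects_le[OF E] by (simp add: rinner_self)
  next
    case 1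
    show ?case using effects_norm_sq[OF E, of x] by (simp add: effects_sym[OF E, of "E x"] rinner_self)
  next
    case (ge2 n)
    show ?case unfolding rinner_blinfun_power_Suc_Suc[OF sa] by (rule ge2(1))
  qed
qed

text \<open>The indices \<open>p\<close> and \<open>q\<close> are left free beyond \<open>n\<close>
  because the uses differ: for powers of an effect they are \<open>n + n\<close> and
  \<open>n + m\<close>, in the factorization they are \<open>m\<close> and \<open>n\<close>.\<close>

lemma Cauchy_if_square_le_Cauchy:
  fixes X :: "nat \<Rightarrow> 'b::real_normed_vector"
  assumes f: "Cauchy (f :: nat \<Rightarrow> real)"
    and le: "\<And>m n. n \<le> m \<Longrightarrow> \<exists>p\<ge>n. \<exists>q\<ge>n. (norm (X m - X n))\<^sup>2 \<le> f p - f q"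
  shows "Cauchy X"
proof (rule metric_CauchyI)
  fix e :: real assume e: "e > 0"
  then obtain M where M: "\<And>m n. m \<ge> M \<Longrightarrow> n \<ge> M \<Longrightarrow> dist (f m) (f n) < e\<^sup>2"
    using metric_CauchyD[OF f, of "e\<^sup>2"] by auto
  have *: "dist (X m) (X n) < e" if mn: "n \<le> m" and n: "M \<le> n" for m n
  proof -
    obtain p q where "p \<ge> n" "q \<ge> n" "(norm (X m - X n))\<^sup>2 \<le> f p - f q"
      using le[OF mn] by blast
    moreover have "f p - f q < e\<^sup>2" if "p \<ge> n" "q \<ge> n" for p q
      using M[of p q] that n by (simp add: dist_real_def)
    ultimately have "(norm (X m - X n))\<^sup>2 < e\<^sup>2" by fastforce
    then show ?thesis using e by (simp add: dist_norm power2_less_imp_less)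
  qed
  show "\<exists>M. \<forall>m\<ge>M. \<forall>n\<ge>M. dist (X m) (X n) < e"
  proof (intro exI allI impI)
    show "dist (X m) (X n) < e" if "m \<ge> M" "n \<ge> M" for m n
      using *[of m n] *[of n m] that by (cases "n \<le> m") (simp_all add: dist_commute)
  qed
qed

text \<open>The inner product of the \<open>j\<close>-th and \<open>k\<close>-th powers at
  \<open>x\<close> is \<open>f (k + j)\<close>, so the squared distance is
  \<open>f (m + m) - 2 * f (n + m) + f (n + n)\<close>, where \<open>f\<close> is decreasing and
  nonnegative.\<close>

lemma blinfun_power_Cauchy:
  assumes E: "E \<in> effects"
  shows "Cauchy (\<lambda>n. blinfun_power E n x)"
proof (rule Cauchy_if_square_le_Cauchy)
  define f where "f n = rinner (blinfun_power E n x) x" for n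
  have dec: "decseq f" unfolding f_def by (rule rinner_blinfun_power_decseq[OF E])
  have "0 \<le> f n" for n
    unfolding f_def by (rule effects_pos[OF effects_blinfun_power[OF E]])
  with decseq_convergent[OF dec, of 0] obtain L where "f \<longlonglongrightarrow> L" by blast
  then show "Cauchy f" by (rule LIMSEQ_imp_Cauchy)
  fix m n :: nat assume nm: "n \<le> m"
  have f: "rinner (blinfun_power E j x) (blinfun_power E k x) = f (k + j)" for j k
    unfolding f_def blinfun_power_add
    by (simp add: effects_sym[OF effects_blinfun_power[OF E], of k])
  have "(norm (blinfun_power E m x - blinfun_power E n x))\<^sup>2 = f (m + m) - 2 * f (n + m) + f (n + n)"
    unfolding rinner_self[symmetric]
    by (simp add: rinner.diff_left rinner.diff_right f add.commute)
  also have "\<dots> \<le> f (n + n) - f (n + m)"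
    using decseqD[OF dec, of "n + m" "m + m"] nm by simp
  finally show "\<exists>p\<ge>n. \<exists>q\<ge>n. (norm (blinfun_power E m x - blinfun_power E n x))\<^sup>2 \<le> f p - f q"
    using le_add1 by blast
qed

lemma effects_limit:
  assumes X: "\<And>n. X n \<in> effects" and lim: "\<And>x. (\<lambda>n. X n x) \<longlonglongrightarrow> blinfun_apply L x"
  shows "L \<in> effects"
  unfolding effects_iff
proof (intro conjI allI)
  show "self_adjoint L" by (rule self_adjoint_limit[OF effects_self_adjoint[OF X] lim])
  fix x
  have l: "(\<lambda>n. rinner (X n x) x) \<longlonglongrightarrow> rinner (L x) x"
    by (rule rinner.tendsto[OF lim tendsto_const])
  show "0 \<le> rinner (L x) x"
    by (rule tendsto_lowerbound[OF l]) (simp_all add: effects_pos[OF X])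
  show "rinner (L x) x \<le> (norm x)\<^sup>2"
    by (rule tendsto_upperbound[OF l]) (simp_all add: effects_le[OF X])
qed

text \<open>The powers of \<open>E = I - C\<close> converge strongly to the projection
  \<open>P\<close> onto the fixed vectors of \<open>E\<close>, that is, onto the kernel of
  \<open>C\<close>; so \<open>H = I - P\<close> is the support projection of \<open>C\<close>. The
  limit formula is exported because \<open>x - E\<^sup>n x\<close> lies in the range of
  \<open>C\<close>.\<close>

lemma effect_support_exists:
  fixes C :: "'h::complex_hilbert_space \<Rightarrow>\<^sub>L 'h"
  assumes C: "C \<in> effects"
  obtains H where "H \<in> effects" "\<And>x. H (H x) = H x" "\<And>x. C (H x) = C x"
    "\<And>x. (\<lambda>n. x - blinfun_power (id_blinfun - C) n x) \<longlonglongrightarrow> blinfun_apply H x"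
proof -
  define E where "E = id_blinfun - C"
  have E: "E \<in> effects" unfolding E_def by (rule effects_compl[OF C])
  obtain P where P: "\<And>x. (\<lambda>n. blinfun_power E n x) \<longlonglongrightarrow> blinfun_apply P x"
    using strong_limit_exists[of "blinfun_power E" 1] blinfun_power_Cauchy[OF E]
      effects_norm[OF effects_blinfun_power[OF E]]
    by auto
  have Peff: "P \<in> effects"
    by (rule effects_limit[OF effects_blinfun_power[OF E] P])
  have EP: "E (P x) = P x" for x
  proof (rule LIMSEQ_unique)
    show "(\<lambda>n. blinfun_power E (Suc n) x) \<longlonglongrightarrow> E (P x)"
      by (simp add: blinfun.tendsto[OF tendsto_const P])
    show "(\<lambda>n. blinfun_power E (Suc n) x) \<longlonglongrightarrow> P x" by (rule LIMSEQ_Suc[OF P])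
  qed
  have PP: "P (P x) = P x" for x
    using P[of "P x"] by (simp add: blinfun_power_fixed[OF EP] LIMSEQ_const_iff)
  define H where "H = id_blinfun - P"
  show thesis
  proof (rule that)
    show "H \<in> effects" unfolding H_def by (rule effects_compl[OF Peff])
    show "H (H x) = H x" for x by (simp add: H_def blinfun.bilinear_simps PP)
    show "C (H x) = C x" for x
      using EP[of x] by (simp add: H_def E_def blinfun.bilinear_simps)
    show "(\<lambda>n. x - blinfun_power (id_blinfun - C) n x) \<longlonglongrightarrow> H x" for x
      using tendsto_diff[OF tendsto_const P, of x x] by (simp add: H_def E_def blinfun.diff_left)
  qed
qed

subsection \<open>Factorization of dominated effects\<close>

text \<open>Partial sums of the Neumann series for an inverse of \<open>id_blinfun - E\<close>. They
  need not converge; only their products with suitable operators will.\<close>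

definition neumann_sum :: "('h::real_normed_vector \<Rightarrow>\<^sub>L 'h) \<Rightarrow> nat \<Rightarrow> ('h \<Rightarrow>\<^sub>L 'h)" where
  "neumann_sum E n = (\<Sum>k<n. blinfun_power E k)"

lemma neumann_sum_0: "neumann_sum E 0 x = 0"
  and neumann_sum_Suc: "neumann_sum E (Suc n) x = neumann_sum E n x + blinfun_power E n x"
  by (simp_all add: neumann_sum_def blinfun.add_left)

lemma neumann_sum_telescope:
  "(id_blinfun - E) (neumann_sum E n x) = x - blinfun_power E n x"
  by (induction n) (simp_all add: neumann_sum_0 neumann_sum_Suc blinfun.bilinear_simps)

lemma neumann_sum_telescope':
  "neumann_sum E n ((id_blinfun - E) x) = x - blinfun_power E n x"
proof (induction n)
  case (Suc n)
  then show ?case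
    using blinfun_power_Suc_right[of E n x]
    by (simp add: neumann_sum_Suc blinfun.bilinear_simps algebra_simps)
qed (simp add: neumann_sum_0)

lemma self_adjoint_neumann_sum: "self_adjoint E \<Longrightarrow> self_adjoint (neumann_sum E n)"
  by (induction n)
     (simp_all add: neumann_sum_def self_adjoint_0 self_adjoint_add self_adjoint_blinfun_power)

text \<open>Inner products of two powers of \<open>E\<close> at \<open>w\<close> are forms of a
  power of \<open>E\<close>, hence nonnegative, so every further summand increases the left-hand
  factor's contribution.\<close>

lemma rinner_neumann_sum_mono:
  assumes E: "E \<in> effects" and "m \<le> n"
  shows "rinner (neumann_sum E m w) (neumann_sum E l w) \<le> rinner (neumann_sum E n w) (neumann_sum E l w)"
  using \<open>m \<le> n\<close>
proof (rule lift_Suc_mono_le[rotated])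
  fix k
  have "0 \<le> rinner (blinfun_power E k w) (neumann_sum E l w)"
  proof (induction l)
    case (Suc l)
    have "rinner (blinfun_power E k w) (blinfun_power E l w) = rinner (blinfun_power E (l + k) w) w"
      unfolding blinfun_power_add
      by (simp add: effects_sym[OF effects_blinfun_power[OF E], of l])
    then show ?case
      using Suc effects_pos[OF effects_blinfun_power[OF E], of "l + k" w]
      by (simp add: neumann_sum_Suc rinner.add_right)
  qed (simp add: neumann_sum_0 rinner.zero_right)
  then show "rinner (neumann_sum E k w) (neumann_sum E l w)
      \<le> rinner (neumann_sum E (Suc k) w) (neumann_sum E l w)"
    by (simp add: neumann_sum_Suc rinner.add_left)
qed

text \<open>
  Both limits \<open>C = lim T F\<^sub>n\<close> and \<open>G = lim F\<^sub>n T\<close> are constructed, because \<open>C\<^sup>*\<close> is not available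
  beforehand; monotonicity of the norms of \<open>F\<^sub>n w\<close> gives the second.
\<close>

lemma effect_factorization:
  fixes A B :: "'h::complex_hilbert_space \<Rightarrow>\<^sub>L 'h"
  assumes A: "A \<in> effects" and B: "B \<in> effects" and AB: "op_le A B"
  shows "\<exists>D\<in>effects. A = op_sqrt B o\<^sub>L D o\<^sub>L op_sqrt B"
proof -
  define S T where "S = op_sqrt B" and "T = op_sqrt A"
  have S: "S \<in> effects" and T: "T \<in> effects"
    unfolding S_def T_def by (rule op_sqrt_effects[OF B], rule op_sqrt_effects[OF A])
  \<comment> \<open>The inequality \<open>A \<le> B\<close> compares the norms of the roots, which
    is the hypothesis of Douglas factorization.\<close>
  have TS: "norm (T v) \<le> norm (S v)" for v
  proof (rule power2_le_imp_le)
    show "(norm (T v))\<^sup>2 \<le> (norm (S v))\<^sup>2"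
      using AB by (simp add: S_def T_def norm_op_sqrt A B op_le_iff)
  qed simp
  define E where "E = id_blinfun - S"
  have E: "E \<in> effects" unfolding E_def by (rule effects_compl[OF S])
  have S_eq: "S = id_blinfun - E" by (simp add: E_def)
  define F where "F = neumann_sum E"
  have SF: "S (F n x) = x - blinfun_power E n x" and FS: "F n (S x) = x - blinfun_power E n x" for n x
    unfolding S_eq F_def by (rule neumann_sum_telescope, rule neumann_sum_telescope')
  have saF: "self_adjoint (F n)" for n
    unfolding F_def by (rule self_adjoint_neumann_sum[OF effects_self_adjoint[OF E]])
  \<comment> \<open>The norms of \<open>F n\<close> may grow, but
    \<open>S F\<^sub>n = I - E\<^sup>n\<close> is an effect; so \<open>S F\<^sub>n\<close>, and with
    it the dominated \<open>T F\<^sub>n\<close>, is a contraction.\<close>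
  have norm_SF: "norm (S (F n x)) \<le> norm x" for n x
    using effects_norm[OF effects_compl[OF effects_blinfun_power[OF E]], of n x]
    by (simp add: SF blinfun.diff_left)
  have TF_bound: "norm (T (F n x)) \<le> norm x" for n x
    by (rule order_trans[OF TS norm_SF])
  have adj: "rinner (F n (T x)) y = rinner x (T (F n y))" for n x y
    unfolding self_adjointD[OF saF, of n "T x"] by (rule effects_sym[OF T])
  \<comment> \<open>A contraction bound passes to the adjoint by testing against the image vector
    \<open>?z\<close> itself.\<close>
  have FT_bound: "norm (F n (T x)) \<le> norm x" for n x
  proof -
    let ?z = "F n (T x)"
    have "norm ?z * norm ?z = rinner x (T (F n ?z))"
      unfolding adj[symmetric] rinner_self power2_eq_square ..
    also have "\<dots> \<le> norm x * norm ?z"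
      by (rule order_trans[OF rinner_le_norm mult_left_mono[OF TF_bound norm_ge_zero]])
    finally show ?thesis by (cases "norm ?z = 0") simp_all
  qed
  have "Cauchy (\<lambda>n. T (F n x))" for x
  proof (rule metric_CauchyI)
    fix e :: real assume "e > 0"
    then obtain M where M: "\<forall>m\<ge>M. \<forall>n\<ge>M. dist (blinfun_power E m x) (blinfun_power E n x) < e"
      using metric_CauchyD[OF blinfun_power_Cauchy[OF E]] by blast
    \<comment> \<open>Domination of \<open>T\<close> by \<open>S\<close> reduces the claim to
      \<open>S (F m x - F n x)\<close>, a difference of two powers of \<open>E\<close> at
      \<open>x\<close>.\<close>
    have "dist (T (F m x)) (T (F n x)) \<le> dist (blinfun_power E m x) (blinfun_power E n x)" for m n
    proof -
      have "norm (T (F m x - F n x)) \<le> norm (S (F m x) - S (F n x))"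
        using TS[of "F m x - F n x"] by (simp add: blinfun.diff_right)
      also have "S (F m x) - S (F n x) = - (blinfun_power E m x - blinfun_power E n x)"
        by (simp add: SF)
      finally show ?thesis by (simp only: dist_norm blinfun.diff_right norm_minus_cancel)
    qed
    then have "dist (T (F m x)) (T (F n x)) < e" if "m \<ge> M" "n \<ge> M" for m n
      using M that by (blast intro: order_le_less_trans)
    then show "\<exists>M. \<forall>m\<ge>M. \<forall>n\<ge>M. dist (T (F m x)) (T (F n x)) < e"
      by blast
  qed
  then have "\<exists>C. \<forall>x. (\<lambda>n. (T o\<^sub>L F n) x) \<longlonglongrightarrow> blinfun_apply C x"
    by (intro strong_limit_exists[where K = 1]) (simp_all add: TF_bound)
  then obtain C where C: "\<And>x. (\<lambda>n. T (F n x)) \<longlonglongrightarrow> blinfun_apply C x"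
    by auto
  have "Cauchy (\<lambda>n. F n (T x))" for x
  proof (rule Cauchy_if_square_le_Cauchy)
    define f where "f n = rinner (F n (T x)) (F n (T x))" for n
    have mono: "rinner (F m (T x)) (F l (T x)) \<le> rinner (F n (T x)) (F l (T x))" if "m \<le> n" for l m n
      unfolding F_def by (rule rinner_neumann_sum_mono[OF E that])
    have inc: "incseq f"
    proof (rule incseq_SucI)
      fix n
      have "f n \<le> rinner (F (Suc n) (T x)) (F n (T x))" unfolding f_def by (rule mono) simp
      also have "\<dots> \<le> f (Suc n)"
        unfolding f_def rinner_commute[of _ "F n (T x)"] by (rule mono) simp
      finally show "f n \<le> f (Suc n)" .
    qed
    have "f n \<le> (norm x)\<^sup>2" for n
      unfolding f_def rinner_self by (rule power_mono[OF FT_bound norm_ge_zero])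
    with incseq_convergent[OF inc, of "(norm x)\<^sup>2"] obtain L where "f \<longlonglongrightarrow> L" by blast
    then show "Cauchy f" by (rule LIMSEQ_imp_Cauchy)
    fix m n :: nat assume nm: "n \<le> m"
    have "(norm (F m (T x) - F n (T x)))\<^sup>2 = f m - 2 * rinner (F m (T x)) (F n (T x)) + f n"
      unfolding rinner_self[symmetric]
      by (simp add: rinner.diff_left rinner.diff_right f_def rinner_commute[of "F n (T x)" "F m (T x)"])
    \<comment> \<open>For \<open>n \<le> m\<close> the cross term is at least
      \<open>f n\<close>.\<close>
    also have "\<dots> \<le> f m - f n"
      using mono[OF nm, of n] by (simp add: f_def)
    finally show "\<exists>p\<ge>n. \<exists>q\<ge>n. (norm (F m (T x) - F n (T x)))\<^sup>2 \<le> f p - f q"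
      using nm by auto
  qed
  then have "\<exists>G. \<forall>x. (\<lambda>n. (F n o\<^sub>L T) x) \<longlonglongrightarrow> blinfun_apply G x"
    by (intro strong_limit_exists[where K = 1]) (simp_all add: FT_bound)
  then obtain G where G: "\<And>x. (\<lambda>n. F n (T x)) \<longlonglongrightarrow> blinfun_apply G x"
    by auto
  have GC: "rinner (G x) y = rinner x (C y)" for x y
  proof (rule LIMSEQ_unique)
    show "(\<lambda>n. rinner (F n (T x)) y) \<longlonglongrightarrow> rinner (G x) y"
      by (rule rinner.tendsto[OF G tendsto_const])
    show "(\<lambda>n. rinner (F n (T x)) y) \<longlonglongrightarrow> rinner x (C y)"
      unfolding adj by (rule rinner.tendsto[OF tendsto_const C])
  qed
  have C_bound: "norm (C x) \<le> norm x" for x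
    by (rule tendsto_upperbound[OF tendsto_norm[OF C]]) (simp_all add: TF_bound)
  have CS: "C (S x) = T x" for x
  proof (rule LIMSEQ_unique)
    obtain H :: "'h \<Rightarrow>\<^sub>L 'h" where SH: "\<And>x. S (H x) = S x"
      and H: "\<And>x. (\<lambda>n. x - blinfun_power E n x) \<longlonglongrightarrow> blinfun_apply H x"
      unfolding E_def by (rule effect_support_exists[OF S]) blast
    \<comment> \<open>\<open>H\<close> is the support projection of \<open>S\<close>, so
      \<open>S\<close> kills \<open>x - H x\<close>, and by domination so does \<open>T\<close>.
      Thus the limit \<open>T (H x)\<close> of \<open>T (F n (S x))\<close> is
      \<open>T x\<close>.\<close>
    have "T (x - H x) = 0"
      using TS[of "x - H x"] by (simp add: blinfun.diff_right SH)
    then have "T (H x) = T x" by (simp add: blinfun.diff_right)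
    moreover have "(\<lambda>n. T (F n (S x))) \<longlonglongrightarrow> T (H x)"
      unfolding FS by (rule blinfun.tendsto[OF tendsto_const H])
    ultimately show "(\<lambda>n. T (F n (S x))) \<longlonglongrightarrow> T x" by simp
    show "(\<lambda>n. T (F n (S x))) \<longlonglongrightarrow> C (S x)" by (rule C)
  qed
  have linear: "complex_linear_op T" "complex_linear_op (F n)" for n
    using effects_self_adjoint[OF T] saF by (simp_all add: self_adjoint_def)
  have "complex_linear_op C"
    by (rule complex_linear_op_limit[of "\<lambda>n. T o\<^sub>L F n"])
       (simp_all add: C complex_linear_op_def linear[unfolded complex_linear_op_def])
  moreover have "complex_linear_op G"
    by (rule complex_linear_op_limit[of "\<lambda>n. F n o\<^sub>L T"])
       (simp_all add: G complex_linear_op_def linear[unfolded complex_linear_op_def])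
  ultimately have "complex_linear_op (G o\<^sub>L C)"
    by (simp add: complex_linear_op_def)
  moreover have form: "rinner (G (C x)) y = rinner (C x) (C y)" for x y
    by (rule GC)
  moreover have "rinner (G (C x)) y = rinner x (G (C y))" for x y
    unfolding rinner_commute[of x] form by (rule rinner_commute)
  ultimately have "self_adjoint (G o\<^sub>L C)"
    unfolding self_adjoint_iff by simp
  then have "G o\<^sub>L C \<in> effects"
    unfolding effects_iff by (simp add: form rinner_self C_bound power_mono)
  \<comment> \<open>As \<open>G\<close> is the adjoint of \<open>C\<close> and
    \<open>C S = T\<close>, the right-hand side has the sesquilinear form of
    \<open>T\<^sup>2 = A\<close>.\<close>
  moreover have "A = S o\<^sub>L (G o\<^sub>L C) o\<^sub>L S"
  proof (rule blinfun_eqI, rule rinner_eqI)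
    fix x z
    have "rinner ((S o\<^sub>L (G o\<^sub>L C) o\<^sub>L S) x) z = rinner (T x) (T z)"
      by (simp add: effects_sym[OF S] GC CS)
    also have "\<dots> = rinner (A x) z"
      unfolding effects_sym[OF T, of "T x" z, symmetric] by (simp add: T_def op_sqrt_square[OF A])
    finally show "rinner (A x) z = rinner ((S o\<^sub>L (G o\<^sub>L C) o\<^sub>L S) x) z" by simp
  qed
  ultimately show ?thesis unfolding S_def by (rule bexI[rotated])
qed

subsection \<open>The sequential product\<close>

lemma effects_sandwich:
  assumes S: "S \<in> effects" and B: "B \<in> effects"
  shows "S o\<^sub>L B o\<^sub>L S \<in> effects"
  unfolding effects_iff
proof (intro conjI allI)
  show "self_adjoint (S o\<^sub>L B o\<^sub>L S)"
    by (rule self_adjoint_sandwich[OF effects_self_adjoint[OF S] effects_self_adjoint[OF B]])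
  fix x
  have eq: "rinner ((S o\<^sub>L B o\<^sub>L S) x) x = rinner (B (S x)) (S x)"
    by (simp add: effects_sym[OF S])
  show "0 \<le> rinner ((S o\<^sub>L B o\<^sub>L S) x) x"
    unfolding eq by (rule effects_pos[OF B])
  show "rinner ((S o\<^sub>L B o\<^sub>L S) x) x \<le> (norm x)\<^sup>2"
    unfolding eq using effects_le[OF B] power_mono[OF effects_norm[OF S] norm_ge_zero]
    by (rule order_trans)
qed

lemma effect_sprod_effects:
  fixes A B :: "'h::complex_hilbert_space \<Rightarrow>\<^sub>L 'h"
  shows "A \<in> effects \<Longrightarrow> B \<in> effects \<Longrightarrow> effect_sprod A B \<in> effects"
  unfolding effect_sprod_def by (intro effects_sandwich op_sqrt_effects)

lemma effect_sprod_apply: "effect_sprod A B x = op_sqrt A (B (op_sqrt A x))"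
  by (simp add: effect_sprod_def)

lemma rinner_effect_sprod:
  fixes A :: "'h::complex_hilbert_space \<Rightarrow>\<^sub>L 'h"
  assumes "A \<in> effects"
  shows "rinner (effect_sprod A B x) y = rinner (B (op_sqrt A x)) (op_sqrt A y)"
  by (simp add: effect_sprod_apply effects_sym[OF op_sqrt_effects[OF assms]])

lemma op_sqrt_idempotent:
  fixes H :: "'h::complex_hilbert_space \<Rightarrow>\<^sub>L 'h"
  assumes "H \<in> effects" "\<And>x. H (H x) = H x"
  shows "op_sqrt H = H"
  using assms by (intro op_sqrt_eqI blinfun_eqI) (simp_all add: effects_def)

text \<open>
  For \<open>N\<close> with commuting adjoint \<open>N\<^sup>*\<close>, the form \<open>quad_iter N c n\<close> is that of the operator
  \<open>(1 - c (N - N\<^sup>*)\<^sup>2 + c\<^sup>2 N\<^sup>*\<^sup>2 N\<^sup>2)\<^sup>n\<close>, which grows at least like \<open>n c\<close> wherever \<open>N\<close> is not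
  self-adjoint and stays below \<open>(1 + c\<^sup>2)\<^sup>n\<close> for a self-adjoint contraction. Taking \<open>c = 1/s\<close> and
  \<open>n = s\<^sup>2\<close>, an operator intertwining the two cases must kill \<open>N - N\<^sup>*\<close>. This replaces
  the Fuglede--Putnam theorem.
\<close>

primrec quad_iter :: "('h::complex_inner_space \<Rightarrow>\<^sub>L 'h) \<Rightarrow> real \<Rightarrow> nat \<Rightarrow> 'h \<Rightarrow> real" where
  "quad_iter N c 0 x = (norm x)\<^sup>2"
| "quad_iter N c (Suc n) x =
     quad_iter N c n (x - c *\<^sub>R N (N x)) + 2 * c * quad_iter N c n (N x)"

lemma norm_diff_scaleR_sq:
  "(norm (x - c *\<^sub>R y))\<^sup>2 = (norm x)\<^sup>2 - 2 * c * rinner y x + c\<^sup>2 * (norm y)\<^sup>2"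
  unfolding rinner_self[symmetric]
  by (simp add: rinner.diff_left rinner.diff_right rinner.scaleR_left rinner.scaleR_right
      rinner_commute[of x y] power2_eq_square algebra_simps)

text \<open>For self-adjoint \<open>P\<close> the cross term \<open>- 2 c\<close> times
  \<open>rinner (P (P x)) x\<close> cancels against \<open>2 c\<close> times
  \<open>(norm (P x))\<^sup>2\<close>. One step thus multiplies the bound by at most
  \<open>1 + c\<^sup>2\<close>.\<close>

lemma quad_iter_le:
  assumes P: "P \<in> effects" and c: "0 \<le> c"
  shows "quad_iter P c n x \<le> (1 + c\<^sup>2) ^ n * (norm x)\<^sup>2"
proof (induction n arbitrary: x)
  case (Suc n)
  have "quad_iter P c (Suc n) x \<le>
      (1 + c\<^sup>2) ^ n * (norm (x - c *\<^sub>R P (P x)))\<^sup>2 + 2 * c * ((1 + c\<^sup>2) ^ n * (norm (P x))\<^sup>2)"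
    unfolding quad_iter.simps by (intro add_mono mult_left_mono Suc) (simp add: c)
  also have "\<dots> = (1 + c\<^sup>2) ^ n * ((norm (x - c *\<^sub>R P (P x)))\<^sup>2 + 2 * c * (norm (P x))\<^sup>2)"
    by (simp add: algebra_simps)
  also have "\<dots> \<le> (1 + c\<^sup>2) ^ n * ((1 + c\<^sup>2) * (norm x)\<^sup>2)"
  proof (rule mult_left_mono)
    have "(norm (x - c *\<^sub>R P (P x)))\<^sup>2 + 2 * c * (norm (P x))\<^sup>2 = (norm x)\<^sup>2 + c\<^sup>2 * (norm (P (P x)))\<^sup>2"
      unfolding norm_diff_scaleR_sq effects_sym[OF P, of "P x"] rinner_self by simp
    also have "\<dots> \<le> (norm x)\<^sup>2 + c\<^sup>2 * (norm x)\<^sup>2"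
      by (intro add_left_mono mult_left_mono power_mono order_trans[OF effects_norm[OF P] effects_norm[OF P]])
         simp_all
    finally show "(norm (x - c *\<^sub>R P (P x)))\<^sup>2 + 2 * c * (norm (P x))\<^sup>2 \<le> (1 + c\<^sup>2) * (norm x)\<^sup>2"
      by (simp add: algebra_simps)
  qed simp
  finally show ?case by (simp add: ac_simps)
qed simp

text \<open>The relation \<open>N W = W P\<close> pulls \<open>W\<close> out of both arguments of
  the recursion, down to the base case where \<open>W\<close> is a contraction.\<close>

lemma quad_iter_intertwine:
  assumes W: "W \<in> effects" and NW: "\<And>y. blinfun_apply N (W y) = W (blinfun_apply P y)" and c: "0 \<le> c"
  shows "quad_iter N c n (W y) \<le> quad_iter P c n y"
proof (induction n arbitrary: y)
  case 0
  then show ?case using power_mono[OF effects_norm[OF W] norm_ge_zero] by simp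
next
  case (Suc n)
  have "W y - c *\<^sub>R N (N (W y)) = W (y - c *\<^sub>R P (P y))"
    by (simp add: NW blinfun.bilinear_simps)
  then show ?case
    using Suc[of "y - c *\<^sub>R P (P y)"] mult_left_mono[OF Suc[of "P y"], of "2 * c"] c
    by (simp add: NW)
qed

text \<open>Here \<open>M\<close> is the adjoint of \<open>N\<close>. With \<open>R = N - M\<close>,
  normality gives \<open>(norm (R v))\<^sup>2 = 2 * (norm (N v))\<^sup>2 - 2 * rinner (N (N v))
  v\<close>, so a single step gains at least \<open>c * (norm (R v))\<^sup>2\<close>.\<close>

lemma quad_iter_ge:
  assumes adj: "\<And>x y. rinner (blinfun_apply N x) y = rinner x (blinfun_apply M y)"
    and normal: "\<And>x. N (M x) = M (N x)" and c: "0 \<le> c"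
  shows "(norm x)\<^sup>2 + real n * c * (norm (N x - M x))\<^sup>2 \<le> quad_iter N c n x"
proof (induction n arbitrary: x)
  case (Suc n)
  define R where "R = N - M"
  have R: "N v - M v = R v" for v by (simp add: R_def blinfun.diff_left)
  have RN: "R (N v) = N (R v)" for v
    by (simp add: R_def blinfun.bilinear_simps normal)
  have step: "(norm v)\<^sup>2 + c * (norm (R v))\<^sup>2 \<le> (norm (v - c *\<^sub>R N (N v)))\<^sup>2 + 2 * c * (norm (N v))\<^sup>2" for v
  proof -
    have "rinner (M v) (M v) = rinner (N v) (N v)"
      using adj[of "M v" v] adj[of v "N v"] normal[of v] by (simp add: rinner_commute)
    then have Rv: "(norm (R v))\<^sup>2 = 2 * (norm (N v))\<^sup>2 - 2 * rinner (N (N v)) v"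
      unfolding rinner_self[symmetric]
      by (simp add: R_def blinfun.diff_left rinner.diff_left rinner.diff_right adj[of "N v" v]
          rinner_commute[of "M v" "N v"])
    show ?thesis
      unfolding norm_diff_scaleR_sq Rv by (simp add: algebra_simps)
  qed
  \<comment> \<open>The one-step gain is used at \<open>x\<close> and at \<open>R x\<close>. Since
    \<open>R\<close> commutes with \<open>N\<close>, the result regroups into the induction
    hypotheses at \<open>x - c *\<^sub>R N (N x)\<close> and at \<open>N x\<close>.\<close>
  have "(norm x)\<^sup>2 + real (Suc n) * c * (norm (R x))\<^sup>2
      \<le> ((norm x)\<^sup>2 + c * (norm (R x))\<^sup>2) + real n * c * ((norm (R x))\<^sup>2 + c * (norm (R (R x)))\<^sup>2)"
    using c by (simp add: algebra_simps)
  also have "\<dots> \<le> ((norm (x - c *\<^sub>R N (N x)))\<^sup>2 + 2 * c * (norm (N x))\<^sup>2)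
      + real n * c * ((norm (R x - c *\<^sub>R N (N (R x))))\<^sup>2 + 2 * c * (norm (N (R x)))\<^sup>2)"
    using c by (intro add_mono step mult_left_mono) simp_all
  also have "\<dots> = ((norm (x - c *\<^sub>R N (N x)))\<^sup>2 + real n * c * (norm (R (x - c *\<^sub>R N (N x))))\<^sup>2)
      + 2 * c * ((norm (N x))\<^sup>2 + real n * c * (norm (R (N x)))\<^sup>2)"
    by (simp add: RN blinfun.bilinear_simps algebra_simps)
  also have "\<dots> \<le> quad_iter N c (Suc n) x"
    unfolding quad_iter.simps using c
    by (intro add_mono mult_left_mono Suc[unfolded R]) simp_all
  finally show ?case unfolding R .
qed simp

lemma normal_intertwine_self_adjoint:
  assumes adj: "\<And>x y. rinner (blinfun_apply N x) y = rinner x (blinfun_apply M y)"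
    and normal: "\<And>x. N (M x) = M (N x)"
    and W: "W \<in> effects" and P: "P \<in> effects"
    and NW: "\<And>y. blinfun_apply N (W y) = W (blinfun_apply P y)"
  shows "N (W y) = M (W y)"
proof -
  let ?r = "(norm (N (W y) - M (W y)))\<^sup>2"
  \<comment> \<open>With \<open>c = 1/s\<close> and \<open>s\<^sup>2\<close> steps the lower bound
    grows linearly in \<open>s\<close>, while \<open>(1 + c\<^sup>2)\<close> to the power
    \<open>s\<^sup>2\<close> stays below \<open>exp 1\<close>.\<close>
  have bound: "real s * ?r \<le> exp 1 * (norm y)\<^sup>2" if s: "s > 0" for s :: nat
  proof -
    let ?c = "1 / real s"
    have "real s * ?r = real (s * s) * ?c * ?r" using s by simp
    also have "\<dots> \<le> (norm (W y))\<^sup>2 + real (s * s) * ?c * ?r" by simp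
    also have "\<dots> \<le> quad_iter N ?c (s * s) (W y)"
      by (rule quad_iter_ge[OF adj normal]) simp_all
    also have "\<dots> \<le> quad_iter P ?c (s * s) y"
      by (rule quad_iter_intertwine[OF W NW]) simp_all
    also have "\<dots> \<le> (1 + ?c\<^sup>2) ^ (s * s) * (norm y)\<^sup>2"
      by (rule quad_iter_le[OF P]) simp
    also have "\<dots> \<le> exp 1 * (norm y)\<^sup>2"
    proof (rule mult_right_mono)
      have "(1 + ?c\<^sup>2) ^ (s * s) \<le> exp (?c\<^sup>2) ^ (s * s)"
        by (intro power_mono exp_ge_add_one_self) simp
      also have "\<dots> = exp (real (s * s) * ?c\<^sup>2)" by (rule exp_of_nat_mult[symmetric])
      also have "real (s * s) * ?c\<^sup>2 = 1" using s by (simp add: power2_eq_square)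
      finally show "(1 + ?c\<^sup>2) ^ (s * s) \<le> exp 1" .
    qed simp
    finally show ?thesis .
  qed
  have "?r = 0"
  proof (rule ccontr)
    assume "?r \<noteq> 0"
    then have "0 < ?r" by simp
    then obtain s where "exp 1 * (norm y)\<^sup>2 < real s * ?r"
      using ex_less_of_nat_mult by blast
    moreover have "0 \<le> exp 1 * (norm y)\<^sup>2" by simp
    moreover from calculation have "s > 0" by (intro gr0I) simp
    ultimately show False using bound[of s] by simp
  qed
  then show ?thesis by simp
qed

text \<open>The hypothesis says that \<open>N = S T\<close> is normal with adjoint
  \<open>T S\<close>. For \<open>W\<close> the root of \<open>S\<close>,
  \<open>N W = W (W T W)\<close> intertwines \<open>N\<close> with an effect, so \<open>S T\<close>
  and \<open>T S\<close> agree on the range of \<open>W\<close>, hence on that of \<open>S\<close>.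
  This gives \<open>S T S = T S\<^sup>2\<close>, and the adjoint identity is
  \<open>S T S = S\<^sup>2 T\<close>.\<close>

lemma commute_if_product_normal:
  fixes S T :: "'h::complex_hilbert_space \<Rightarrow>\<^sub>L 'h"
  assumes S: "S \<in> effects" and T: "T \<in> effects"
    and normal: "\<And>x. S (T (T (S x))) = T (S (S (T x)))"
  shows "T (S (S x)) = S (S (T x))"
proof -
  define W where "W = op_sqrt S"
  have W: "W \<in> effects" and WW: "\<And>x. W (W x) = S x"
    unfolding W_def by (rule op_sqrt_effects[OF S], rule op_sqrt_square[OF S])
  have "(S o\<^sub>L T) (W y) = (T o\<^sub>L S) (W y)" for y
  proof (rule normal_intertwine_self_adjoint[OF _ _ W effects_sandwich[OF W T]])
    show "rinner ((S o\<^sub>L T) x) y = rinner x ((T o\<^sub>L S) y)" for x y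
      by (simp add: effects_sym[OF S] effects_sym[OF T])
  qed (simp_all add: normal WW)
  from this[of "W _"] have STS: "S (T (S x)) = T (S (S x))" for x
    by (simp add: WW)
  show ?thesis
  proof (rule rinner_eqI)
    fix z
    have "rinner (S (S (T x))) z = rinner x (T (S (S z)))"
      by (simp add: effects_sym[OF S] effects_sym[OF T])
    also have "\<dots> = rinner (S (T (S x))) z"
      by (simp add: effects_sym[OF S] effects_sym[OF T] flip: STS)
    finally show "rinner (T (S (S x))) z = rinner (S (S (T x))) z"
      by (simp only: STS)
  qed
qed

lemma effect_sprod_eq_product:
  fixes A B :: "'h::complex_hilbert_space \<Rightarrow>\<^sub>L 'h"
  assumes A: "A \<in> effects" and comm: "\<And>x. A (B x) = B (A x)"
  shows "effect_sprod A B x = A (B x)"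
proof -
  have "B (op_sqrt A x) = op_sqrt A (B x)"
    by (rule op_sqrt_commute[OF A]) (simp add: comm)
  then show ?thesis by (simp add: effect_sprod_apply op_sqrt_square[OF A])
qed

text \<open>In terms of the roots, \<open>A \<circ> B = B \<circ> A\<close> reads
  \<open>S T\<^sup>2 S = T S\<^sup>2 T\<close>, which is normality of \<open>S T\<close>. Then
  \<open>T\<close> commutes with \<open>A\<close>, and so does \<open>B = T\<^sup>2\<close>. This
  turns compatibility in the axioms into ordinary commutation.\<close>

lemma effect_sprod_commute_iff:
  fixes A B :: "'h::complex_hilbert_space \<Rightarrow>\<^sub>L 'h"
  assumes A: "A \<in> effects" and B: "B \<in> effects"
  shows "effect_sprod A B = effect_sprod B A \<longleftrightarrow> (\<forall>x. A (B x) = B (A x))"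
proof
  assume eq: "effect_sprod A B = effect_sprod B A"
  define S T where "S = op_sqrt A" and "T = op_sqrt B"
  have S: "S \<in> effects" and T: "T \<in> effects"
    unfolding S_def T_def by (rule op_sqrt_effects[OF A], rule op_sqrt_effects[OF B])
  have SS: "S (S x) = A x" and TT: "T (T x) = B x" for x
    unfolding S_def T_def by (rule op_sqrt_square[OF A], rule op_sqrt_square[OF B])
  have "S (T (T (S x))) = T (S (S (T x)))" for x
    using arg_cong[OF eq, of "\<lambda>Z. blinfun_apply Z x"]
    by (simp add: effect_sprod_apply SS TT flip: S_def T_def)
  then have "T (A x) = A (T x)" for x
    using commute_if_product_normal[OF S T] by (simp add: SS)
  then show "\<forall>x. A (B x) = B (A x)" by (simp flip: TT)
next
  assume comm: "\<forall>x. A (B x) = B (A x)"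
  show "effect_sprod A B = effect_sprod B A"
  proof (rule blinfun_eqI)
    fix x
    have "effect_sprod A B x = A (B x)" "effect_sprod B A x = B (A x)"
      by (rule effect_sprod_eq_product; simp add: A B comm)+
    then show "effect_sprod A B x = effect_sprod B A x" by (simp add: comm)
  qed
qed

subsection \<open>The effect algebra of effects\<close>

lemma effect_oplus_Some_iff:
  "effect_oplus A B = Some C \<longleftrightarrow> A \<in> effects \<and> B \<in> effects \<and> A + B \<in> effects \<and> C = A + B"
  by (auto simp: effect_oplus_def)

lemma effects_diff:
  assumes A: "A \<in> effects" and B: "B \<in> effects" and le: "op_le A B"
  shows "B - A \<in> effects"
  unfolding effects_iff
proof (intro conjI allI)
  show "self_adjoint (B - A)"
    by (intro self_adjoint_diff effects_self_adjoint A B)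
  fix x
  show "0 \<le> rinner ((B - A) x) x"
    using le by (simp add: op_le_iff blinfun.diff_left rinner.diff_left)
  show "rinner ((B - A) x) x \<le> (norm x)\<^sup>2"
    using effects_pos[OF A, of x] effects_le[OF B, of x]
    by (simp add: blinfun.diff_left rinner.diff_left)
qed

lemma effect_algebra_effects:
  assumes nontrivial: "\<exists>x::'h::complex_hilbert_space. x \<noteq> 0"
  shows "effect_algebra (effects :: ('h \<Rightarrow>\<^sub>L 'h) set) 0 id_blinfun effect_oplus"
proof
  show "0 \<in> (effects :: ('h \<Rightarrow>\<^sub>L 'h) set)" by (rule effects_0)
  show "id_blinfun \<in> (effects :: ('h \<Rightarrow>\<^sub>L 'h) set)" by (rule effects_id)
  show "(0 :: 'h \<Rightarrow>\<^sub>L 'h) \<noteq> id_blinfun"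
    using nontrivial by (metis blinfun.zero_left blinfun_apply_id_blinfun)
  fix A B C D E :: "'h \<Rightarrow>\<^sub>L 'h"
  show "A \<in> effects \<and> B \<in> effects \<and> C \<in> effects" if "effect_oplus A B = Some C"
    using that by (auto simp: effect_oplus_Some_iff)
  show "effect_oplus B A = Some C" if "effect_oplus A B = Some C"
    using that by (simp add: effect_oplus_Some_iff add.commute)
  show "\<exists>F. effect_oplus B C = Some F \<and> effect_oplus A F = Some E"
    if "effect_oplus A B = Some D" "effect_oplus D C = Some E"
  proof -
    have A: "A \<in> effects" and B: "B \<in> effects" and C: "C \<in> effects"
      and ABC: "A + B + C \<in> effects" and E: "E = A + B + C"
      using that by (auto simp: effect_oplus_Some_iff)
    \<comment> \<open>\<open>B + C\<close> is recognized as an effect by subtracting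
      \<open>A\<close> from the larger effect \<open>A + B + C\<close>.\<close>
    have "(A + B + C) - A \<in> effects"
      using effects_pos[OF B] effects_pos[OF C]
      by (intro effects_diff A ABC) (simp add: op_le_iff blinfun.add_left rinner.add_left)
    then have "B + C \<in> effects" by (simp add: add.assoc)
    with A B C ABC show ?thesis by (simp add: effect_oplus_Some_iff E add.assoc)
  qed
  show "\<exists>!B. B \<in> effects \<and> effect_oplus A B = Some id_blinfun" if "A \<in> effects"
  proof (rule ex1I[of _ "id_blinfun - A"])
    show "id_blinfun - A \<in> effects \<and> effect_oplus A (id_blinfun - A) = Some id_blinfun"
      using that by (simp add: effect_oplus_Some_iff effects_compl effects_id)
  qed (auto simp: effect_oplus_Some_iff eq_diff_eq add.commute)
  show "A = 0" if "effect_oplus A id_blinfun = Some B"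
  proof (rule op_le_antisym)
    have A: "A \<in> effects" and A1: "A + id_blinfun \<in> effects"
      using that by (auto simp: effect_oplus_Some_iff)
    show "A \<in> effects" by (rule A)
    show "op_le A 0"
      using effects_le[OF A1] by (simp add: op_le_iff blinfun.add_left rinner.add_left rinner_self rinner.zero_left)
    show "op_le 0 A" using A by (simp add: effects_def)
  qed (rule effects_0)
qed

section \<open>Order, sharp effects and least sharp upper bounds\<close>

context
  assumes nontrivial: "\<exists>x::'h::complex_hilbert_space. x \<noteq> 0"
begin

interpretation effect_algebra "effects :: ('h \<Rightarrow>\<^sub>L 'h) set" 0 id_blinfun effect_oplus
  by (rule effect_algebra_effects[OF nontrivial])

lemma effects_le_iff: "le A B \<longleftrightarrow> A \<in> effects \<and> B \<in> effects \<and> op_le A B"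
proof
  show "A \<in> effects \<and> B \<in> effects \<and> op_le A B" if "le A B"
    using that effects_pos
    by (auto simp: le_def effect_oplus_Some_iff op_le_iff blinfun.add_left rinner.add_left)
  show "le A B" if "A \<in> effects \<and> B \<in> effects \<and> op_le A B"
    using that effects_diff[of A B] unfolding le_def
    by (intro bexI[of _ "B - A"]) (simp_all add: effect_oplus_Some_iff)
qed

lemma effects_compl_eq: "A \<in> effects \<Longrightarrow> compl A = id_blinfun - A"
  unfolding compl_def
  by (rule the_equality) (auto simp: effect_oplus_Some_iff effects_compl effects_id eq_diff_eq add.commute)

text \<open>The effect \<open>D = A - A\<^sup>2\<close> lies below \<open>A\<close> and below
  \<open>I - A\<close>, the differences being \<open>A\<^sup>2\<close> and
  \<open>(I - A)\<^sup>2\<close>; a zero meet therefore forces \<open>D = 0\<close>. Conversely, for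
  a projection \<open>A\<close>, an effect below \<open>I - A\<close> kills the range of
  \<open>A\<close>, and one below \<open>A\<close> kills its kernel.\<close>

lemma sharp_effects_iff: "A \<in> sharp_elements \<longleftrightarrow> A \<in> effects \<and> (\<forall>x. A (A x) = A x)"
proof (cases "A \<in> effects")
  case A: True
  let ?B = "id_blinfun - A"
  have B: "?B \<in> effects" by (rule effects_compl[OF A])
  have "is_meet A ?B 0 \<longleftrightarrow> (\<forall>x. A (A x) = A x)"
  proof
    assume meet: "is_meet A ?B 0"
    define D where "D = A - (A o\<^sub>L A)"
    have quad: "rinner (A (A x)) x = (norm (A x))\<^sup>2" for x
      by (simp add: effects_sym[OF A, of "A x"] rinner_self)
    have D: "D \<in> effects"
      unfolding effects_iff
    proof (intro conjI allI)
      show "self_adjoint D"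
        unfolding D_def by (intro self_adjoint_diff self_adjoint_compose effects_self_adjoint A) simp
      show "0 \<le> rinner (D x) x" for x
        using effects_norm_sq[OF A, of x] by (simp add: D_def blinfun.diff_left rinner.diff_left quad)
      show "rinner (D x) x \<le> (norm x)\<^sup>2" for x
        using effects_le[OF A, of x] zero_le_power2[of "norm (A x)"]
        by (simp only: D_def blinfun.diff_left rinner.diff_left quad blinfun_apply_blinfun_compose)
    qed
    moreover have "op_le D A"
      by (simp add: op_le_iff D_def blinfun.diff_left rinner.diff_left quad)
    moreover have "op_le D ?B"
      unfolding op_le_iff
    proof
      fix x
      have "0 \<le> (norm (x - A x))\<^sup>2" by simp
      also have "\<dots> = rinner (?B x) x - rinner (D x) x"
        using norm_diff_scaleR_sq[of x 1 "A x"]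
        by (simp add: D_def blinfun.diff_left rinner.diff_left quad rinner_self)
      finally show "rinner (D x) x \<le> rinner (?B x) x" by simp
    qed
    ultimately have "le D 0"
      using meet A B by (simp add: is_meet_def effects_le_iff)
    then have "rinner (D x) x \<le> 0" for x
      by (simp add: effects_le_iff op_le_iff rinner.zero_left)
    then have "D x = 0" for x by (rule effects_apply_eq_0[OF D])
    then show "\<forall>x. A (A x) = A x" by (simp add: D_def blinfun.diff_left)
  next
    assume AA: "\<forall>x. A (A x) = A x"
    show "is_meet A ?B 0"
      unfolding is_meet_def effects_le_iff
    proof (intro conjI ballI impI; (elim conjE)?)
      show "op_le 0 A" "op_le 0 ?B" using A B by (simp_all add: effects_def)
      fix C assume C: "C \<in> effects" and CA: "op_le C A" and CB: "op_le C ?B"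
      show "op_le C 0"
        unfolding op_le_iff
      proof
        fix x
        have "C (A x) = 0"
          using CB[unfolded op_le_iff, rule_format, of "A x"]
          by (intro effects_apply_eq_0[OF C]) (simp add: AA blinfun.diff_left rinner.zero_left)
        moreover have "C (x - A x) = 0"
          using CA[unfolded op_le_iff, rule_format, of "x - A x"]
          by (intro effects_apply_eq_0[OF C]) (simp add: AA blinfun.diff_right rinner.zero_left)
        ultimately have "C x = 0" by (simp add: blinfun.diff_right)
        then show "rinner (C x) x \<le> rinner (blinfun_apply 0 x) x" by simp
      qed
    qed (use A B effects_0 in auto)
  qed
  with A show ?thesis by (simp add: sharp_elements_def effects_compl_eq)
qed (simp add: sharp_elements_def)

text \<open>The support projection \<open>H\<close> dominates because the form of \<open>C\<close>
  at \<open>x\<close> is its form at \<open>H x\<close>. If a projection \<open>Q\<close> lies above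
  \<open>C\<close>, then \<open>C\<close> kills the kernel of \<open>Q\<close>, so
  \<open>I - C\<close> fixes it pointwise and \<open>H\<close> kills it. Hence
  \<open>H = H Q\<close> and \<open>norm (H x) \<le> norm (Q x)\<close>.\<close>

lemma effect_support_least_sharp:
  assumes C: "C \<in> effects"
  obtains H where "is_least_sharp_above C H"
    "\<And>x. (\<lambda>n. x - blinfun_power (id_blinfun - C) n x) \<longlonglongrightarrow> blinfun_apply H x"
proof -
  obtain H :: "'h \<Rightarrow>\<^sub>L 'h" where H: "H \<in> effects" and HH: "\<And>x. H (H x) = H x"
    and CH: "\<And>x. C (H x) = C x"
    and lim: "\<And>x. (\<lambda>n. x - blinfun_power (id_blinfun - C) n x) \<longlonglongrightarrow> blinfun_apply H x"
    by (rule effect_support_exists[OF C]) blast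
  have normH: "rinner (H x) x = (norm (H x))\<^sup>2" for x
    using effects_sym[OF H, of "H x" x] by (simp add: HH rinner_self)
  have "op_le C H"
    unfolding op_le_iff
  proof
    fix x
    have "rinner (C x) x = rinner (C (H x)) (H x)"
      using effects_sym[OF C, of x x] effects_sym[OF C, of "H x" "H x"] effects_sym[OF C, of "H x" x]
      by (simp add: CH)
    also have "\<dots> \<le> rinner (H x) x" unfolding normH by (rule effects_le[OF C])
    finally show "rinner (C x) x \<le> rinner (H x) x" .
  qed
  moreover have "op_le H Q" if Q: "Q \<in> effects" and QQ: "\<forall>x. Q (Q x) = Q x" and CQ: "op_le C Q" for Q
    unfolding op_le_iff
  proof
    fix x
    let ?v = "x - Q x"
    have "Q ?v = 0" by (simp add: blinfun.diff_right QQ)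
    then have "C ?v = 0"
      using CQ[unfolded op_le_iff, rule_format, of ?v]
      by (intro effects_apply_eq_0[OF C]) (simp add: rinner.zero_left)
    then have "(id_blinfun - C) ?v = ?v" by (simp add: blinfun.diff_left)
    then have "H ?v = 0"
      using lim[of ?v] by (simp add: blinfun_power_fixed LIMSEQ_const_iff)
    then have "H x = H (Q x)" by (simp add: blinfun.diff_right)
    then have "rinner (H x) x \<le> (norm (Q x))\<^sup>2"
      unfolding normH by (simp add: effects_norm[OF H] power_mono)
    also have "\<dots> = rinner (Q x) x"
      using effects_sym[OF Q, of "Q x" x] by (simp add: QQ rinner_self)
    finally show "rinner (H x) x \<le> rinner (Q x) x" .
  qed
  ultimately have "is_least_sharp_above C H"
    using C H HH by (simp add: is_least_sharp_above_def sharp_effects_iff effects_le_iff)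
  then show thesis using lim by (rule that)
qed

lemma least_sharp_above_unique:
  assumes "is_least_sharp_above C H" "is_least_sharp_above C K"
  shows "H = K"
  using assms op_le_antisym[of H K]
  by (simp add: is_least_sharp_above_def effects_le_iff)

text \<open>The hypothesis compares the forms of \<open>A\<close> and \<open>B\<close> on the range
  of the root of \<open>C\<close>. Vectors of that range approximate every \<open>H x\<close>, and
  the comparison passes to the limit.\<close>

lemma effect_sprod_le_imp_hat:
  assumes A: "A \<in> effects" and B: "B \<in> effects" and C: "C \<in> effects"
    and le: "op_le (effect_sprod C A) (effect_sprod C B)"
  shows "le (effect_sprod (sharp_hat C) A) (effect_sprod (sharp_hat C) B)"
proof -
  obtain H where H: "is_least_sharp_above C H"
    and lim: "\<And>x. (\<lambda>n. x - blinfun_power (id_blinfun - C) n x) \<longlonglongrightarrow> blinfun_apply H x"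
    using effect_support_least_sharp[OF C] by metis
  have hat: "sharp_hat C = H"
    unfolding sharp_hat_def using H least_sharp_above_unique by (intro the_equality) blast+
  have Heff: "H \<in> effects" and HH: "\<And>x. H (H x) = H x"
    using H by (simp_all add: is_least_sharp_above_def sharp_effects_iff)
  have sqrt_H: "op_sqrt H = H" by (rule op_sqrt_idempotent[OF Heff HH])
  have "rinner (A (H x)) (H x) \<le> rinner (B (H x)) (H x)" for x
  proof (rule LIMSEQ_le)
    define y where "y n = x - blinfun_power (id_blinfun - C) n x" for n
    have y: "y \<longlonglongrightarrow> H x" unfolding y_def by (rule lim)
    have form: "(\<lambda>n. rinner (Z (y n)) (y n)) \<longlonglongrightarrow> rinner (blinfun_apply Z (H x)) (H x)" for Z :: "'h \<Rightarrow>\<^sub>L 'h"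
      by (intro rinner.tendsto blinfun.tendsto tendsto_const y)
    show "(\<lambda>n. rinner (A (y n)) (y n)) \<longlonglongrightarrow> rinner (A (H x)) (H x)"
      and "(\<lambda>n. rinner (B (y n)) (y n)) \<longlonglongrightarrow> rinner (B (H x)) (H x)"
      by (rule form)+
    have "rinner (A (y n)) (y n) \<le> rinner (B (y n)) (y n)" for n
    proof -
      \<comment> \<open>By telescoping, \<open>y n\<close> is \<open>C\<close> applied to a Neumann
        sum; splitting \<open>C\<close> into two roots exhibits \<open>y n\<close> in the range of
        \<open>op_sqrt C\<close>.\<close>
      define z where "z = op_sqrt C (neumann_sum (id_blinfun - C) n x)"
      have "y n = op_sqrt C z"
        using neumann_sum_telescope[of "id_blinfun - C" n x]
        by (simp add: y_def z_def op_sqrt_square[OF C])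
      then show ?thesis
        using le by (simp add: op_le_iff rinner_effect_sprod[OF C])
    qed
    then show "\<exists>N. \<forall>n\<ge>N. rinner (A (y n)) (y n) \<le> rinner (B (y n)) (y n)" by blast
  qed
  then show ?thesis
    unfolding hat effects_le_iff
    by (simp add: effect_sprod_effects A B Heff op_le_iff rinner_effect_sprod[OF Heff] sqrt_H)
qed

end

section \<open>Axioms of the sequential product and of the sequential order\<close>

lemma effect_sprod_id:
  fixes A :: "'h::complex_hilbert_space \<Rightarrow>\<^sub>L 'h"
  shows "effect_sprod id_blinfun A = A"
  by (rule blinfun_eqI)
     (simp add: effect_sprod_def op_sqrt_idempotent[OF effects_id])

text \<open>The form of \<open>A \<circ> B\<close> at \<open>x\<close> is that of \<open>B\<close>
  at \<open>op_sqrt A x\<close>. Its vanishing gives \<open>B A = 0\<close>, and taking adjoints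
  gives \<open>A B = 0\<close>.\<close>

lemma effect_sprod_eq_0_commute:
  fixes A B :: "'h::complex_hilbert_space \<Rightarrow>\<^sub>L 'h"
  assumes A: "A \<in> effects" and B: "B \<in> effects" and zero: "effect_sprod A B = 0"
  shows "effect_sprod A B = effect_sprod B A"
proof -
  have BS: "B (op_sqrt A x) = 0" for x
    using rinner_effect_sprod[OF A, of B x x] zero
    by (intro effects_apply_eq_0[OF B]) (simp add: rinner.zero_left)
  have BA: "B (A x) = 0" for x
    using BS[of "op_sqrt A x"] by (simp add: op_sqrt_square[OF A])
  have "A (B x) = 0" for x
    by (rule rinner_eqI) (simp add: effects_sym[OF A] effects_sym[OF B] BA rinner.zero_left rinner.zero_right)
  with BA show ?thesis by (simp add: effect_sprod_commute_iff[OF A B])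
qed

text \<open>The roots \<open>S\<close> and \<open>T\<close> commute as well, so \<open>S T\<close>
  is the positive root of \<open>A \<circ> B\<close>, and both sides become
  \<open>S T C T S\<close>.\<close>

lemma effect_sprod_assoc:
  fixes A B C :: "'h::complex_hilbert_space \<Rightarrow>\<^sub>L 'h"
  assumes A: "A \<in> effects" and B: "B \<in> effects" and comm: "\<And>x. A (B x) = B (A x)"
  shows "effect_sprod A (effect_sprod B C) = effect_sprod (effect_sprod A B) C"
proof -
  define S T where "S = op_sqrt A" and "T = op_sqrt B"
  have S: "S \<in> effects" and T: "T \<in> effects"
    unfolding S_def T_def by (rule op_sqrt_effects[OF A], rule op_sqrt_effects[OF B])
  have SS: "S (S x) = A x" and TT: "T (T x) = B x" for x
    unfolding S_def T_def by (rule op_sqrt_square[OF A], rule op_sqrt_square[OF B])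
  have "A (T x) = T (A x)" for x
    unfolding T_def by (rule op_sqrt_commute[OF B comm])
  then have TS: "T (S x) = S (T x)" for x
    unfolding S_def by (intro op_sqrt_commute[OF A]) simp
  have "op_sqrt (effect_sprod A B) = S o\<^sub>L T"
  proof (rule op_sqrt_eqI[OF effect_sprod_effects[OF A B]])
    show "self_adjoint (S o\<^sub>L T)"
      by (rule self_adjoint_compose[OF effects_self_adjoint[OF S] effects_self_adjoint[OF T]]) (simp add: TS)
    show "(S o\<^sub>L T) o\<^sub>L (S o\<^sub>L T) = effect_sprod A B"
      by (rule blinfun_eqI) (simp add: effect_sprod_eq_product[OF A comm] TS SS TT)
    show "op_le 0 (S o\<^sub>L T)"
      unfolding op_le_iff
    proof
      fix x
      \<comment> \<open>A product of commuting positive operators is positive: the form of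
        \<open>S T\<close> at \<open>x\<close> is that of \<open>T\<close> at \<open>W x\<close>,
        where \<open>W\<close> is the root of \<open>S\<close>.\<close>
      define W where "W = op_sqrt S"
      have W: "W \<in> effects" and WW: "\<And>x. W (W x) = S x"
        unfolding W_def by (rule op_sqrt_effects[OF S], rule op_sqrt_square[OF S])
      have "T (W x) = W (T x)" for x
        unfolding W_def by (rule op_sqrt_commute[OF S TS])
      then have "rinner (S (T x)) x = rinner (T (W x)) (W x)"
        by (simp add: effects_sym[OF W] flip: WW)
      then show "rinner (blinfun_apply 0 x) x \<le> rinner ((S o\<^sub>L T) x) x"
        using effects_pos[OF T] by (simp add: rinner.zero_left)
    qed
  qed
  then show ?thesis
    by (intro blinfun_eqI) (simp add: effect_sprod_apply TS flip: S_def T_def)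
qed

theorem theorem5p1:
  assumes "\<exists>x::'h::complex_hilbert_space. x \<noteq> 0"
  shows "sequentially_ordered_sea
           (effects :: ('h \<Rightarrow>\<^sub>L 'h) set) 0 id_blinfun effect_oplus effect_sprod"
proof -
  interpret effect_algebra "effects :: ('h \<Rightarrow>\<^sub>L 'h) set" 0 id_blinfun effect_oplus
    by (rule effect_algebra_effects[OF assms])
  note le_iff = effects_le_iff[OF assms]
  show ?thesis
  proof
    fix A B C D :: "'h \<Rightarrow>\<^sub>L 'h"
    show "effect_sprod A B \<in> effects" if "A \<in> effects" "B \<in> effects"
      using that by (rule effect_sprod_effects)
    show "effect_oplus (effect_sprod A B) (effect_sprod A C) = Some (effect_sprod A D)"
      if A: "A \<in> effects" and BC: "effect_oplus B C = Some D"
    proof -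
      have "B \<in> effects" "C \<in> effects" "B + C \<in> effects" and D: "D = B + C"
        using BC by (simp_all add: effect_oplus_Some_iff)
      moreover have "effect_sprod A B + effect_sprod A C = effect_sprod A (B + C)"
        by (rule blinfun_eqI) (simp add: effect_sprod_apply blinfun.bilinear_simps)
      ultimately show ?thesis
        using A by (simp add: effect_oplus_Some_iff effect_sprod_effects)
    qed
    show "effect_sprod id_blinfun A = A"
      by (rule effect_sprod_id)
    show "effect_sprod A B = effect_sprod B A"
      if "A \<in> effects" "B \<in> effects" "effect_sprod A B = 0"
      using that by (rule effect_sprod_eq_0_commute)
    show "effect_sprod A (compl B) = effect_sprod (compl B) A"
      if "A \<in> effects" "B \<in> effects" "effect_sprod A B = effect_sprod B A"
      using that by (simp add: effects_compl_eq[OF assms] effect_sprod_commute_iff effects_compl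
          blinfun.bilinear_simps)
    show "effect_sprod A (effect_sprod B C) = effect_sprod (effect_sprod A B) C"
      if "A \<in> effects" "B \<in> effects" "C \<in> effects" "effect_sprod A B = effect_sprod B A"
      using that by (intro effect_sprod_assoc) (simp_all add: effect_sprod_commute_iff)
    show "effect_sprod C (effect_sprod A B) = effect_sprod (effect_sprod A B) C"
      if A: "A \<in> effects" and B: "B \<in> effects" and C: "C \<in> effects"
        and CA: "effect_sprod C A = effect_sprod A C" and CB: "effect_sprod C B = effect_sprod B C"
    proof -
      have "C (A x) = A (C x)" and CB': "C (B x) = B (C x)" for x
        using CA CB by (simp_all add: effect_sprod_commute_iff A B C)
      \<comment> \<open>The root of \<open>A\<close> lies in the bicommutant of \<open>A\<close>, so
        \<open>C\<close> commutes with all three factors of \<open>A \<circ> B\<close>.\<close>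
      then have "C (op_sqrt A x) = op_sqrt A (C x)" for x
        by (intro op_sqrt_commute[OF A])
      then show ?thesis
        by (simp add: effect_sprod_commute_iff effect_sprod_effects A B C effect_sprod_apply CB')
    qed
    show "effect_sprod C D = effect_sprod D C"
      if "C \<in> effects" "effect_sprod C A = effect_sprod A C" "effect_sprod C B = effect_sprod B C"
        "effect_oplus A B = Some D"
      using that by (simp add: effect_oplus_Some_iff effect_sprod_commute_iff blinfun.bilinear_simps)
    show "sharply_dominating"
      unfolding sharply_dominating_def using effect_support_least_sharp[OF assms] by metis
    show "\<exists>D\<in>effects. A = effect_sprod B D" if "A \<in> effects" "B \<in> effects" "le A B"
      unfolding effect_sprod_def using that by (intro effect_factorization) (simp_all add: le_iff)
    show "le (effect_sprod (sharp_hat C) A) (effect_sprod (sharp_hat C) B)"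
      if "A \<in> effects" "B \<in> effects" "C \<in> effects" "le (effect_sprod C A) (effect_sprod C B)"
      using that by (intro effect_sprod_le_imp_hat[OF assms]) (simp_all add: le_iff)
  qed
qed

end
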